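(* Let $H_1,H_2$ be Hilbert spaces over $\mathbb{C}$, let $T\in B(H_1,H_2)$, and let $(s_k)_{k\in\mathbb{N}}$ be any $s$-number function. Suppose $(P_n)$ and $(Q_n)$ are sequences of operators in $B(H_1)$ and $B(H_2)$ respectively such that for all $n\in\mathbb{N}$, $\|P_n\|\,\|Q_n\|\le 1$, and such that $T_n:=Q_nTP_n$ converges to $T$ in the weak$^*$ sense of operator convergence. Then for each $k\in\mathbb{N}$, $$\lim_{n\to\infty}s_k(T_n)=s_k(T).$$
   Context: $B(X,Y)$ is the space of bounded linear operators from $X$ to $Y$ with the operator norm, and $B(X)=B(X,X)$. An $s$-number function (in the sense of Pietsch) assigns to every bounded linear operator $S$ between Banach spaces a sequence $(s_k(S))_{k\ge1}$ of nonnegative reals such that: (1) $\|S\|=s_1(S)\ge s_2(S)\ge\cdots\ge 0$; (2) $s_k(S+R)\le s_k(S)+\|R\|$ for $S,R\in B(X,Y)$; (3) $s_k(USV)\le\|U\|\,s_k(S)\,\|V\|$ for $V\in B(X_0,X)$, $S\in B(X,Y)$, $U\in B(Y,Y_0)$; (4) $s_k(S)=0$ whenever $\operatorname{rank}(S)<k$; (5) $s_k(I_{\ell_2^k})=1$, where $I_{\ell_2^k}$ is the identity on $k$-dimensional Hilbert space. If $Y$ is (isometrically isomorphic to) the dual $Z'$ of a normed space $Z$, a sequence $(T_n)$ in $B(X,Y)$ converges to $T$ in the weak$^*$ sense if for each $x\in X$ and $z\in Z$, $|(T_nx)(z)-(Tx)(z)|\to0$. For a Hilbert space $H_2$, regarded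 as a dual space, this means $\langle T_nx,y\rangle\to\langle Tx,y\rangle$ for all $x\in H_1$, $y\in H_2$. *)

theory Defs
  imports "HOL-Analysis.Analysis" "HOL-Algebra.Module"
begin

text \<open>
  An s-number function takes operators between arbitrary Banach spaces as arguments, so Banach
  spaces have to be values rather than types. They are records whose carrier is a subset of a
  type \<open>'u\<close>, and \<open>'u\<close> stays an arbitrary type parameter throughout: any given
  Banach spaces can be carried by a common \<open>'u\<close>, and an s-number function on all Banach spaces
  restricts to one on those carried by \<open>'u\<close>. The record fields \<open>mult\<close> and
  \<open>one\<close>, which every HOL-Algebra module inherits from \<open>ring\<close>, play no role.
\<close>

definition complex_ring :: "complex ring" where
  "complex_ring = \<lparr>carrier = UNIV, monoid.mult = (*), one = 1, ring.zero = 0, add = (+)\<rparr>"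

record 'u cnormed = "(complex, 'u) module" +
  nrm :: "'u \<Rightarrow> real"

locale cnormed_space = Module.module complex_ring X
  for X :: "'u cnormed" (structure) +
  assumes nrm_nonneg: "x \<in> carrier X \<Longrightarrow> 0 \<le> nrm X x"
    and nrm_eq_0_imp: "\<lbrakk>x \<in> carrier X; nrm X x = 0\<rbrakk> \<Longrightarrow> x = \<zero>"
    and nrm_smult: "x \<in> carrier X \<Longrightarrow> nrm X (c \<odot> x) = cmod c * nrm X x"
    and nrm_triangle: "\<lbrakk>x \<in> carrier X; y \<in> carrier X\<rbrakk> \<Longrightarrow> nrm X (x \<oplus> y) \<le> nrm X x + nrm X y"

locale cbanach_space = cnormed_space +
  assumes complete: "Metric_space.mcomplete (carrier X) (\<lambda>x y. nrm X (x \<ominus> y))"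

locale chilbert_space = cbanach_space X for X :: "'u cnormed" (structure) +
  fixes ip :: "'u \<Rightarrow> 'u \<Rightarrow> complex"
  assumes ip_add_left: "\<lbrakk>x \<in> carrier X; y \<in> carrier X; z \<in> carrier X\<rbrakk>
            \<Longrightarrow> ip (x \<oplus> y) z = ip x z + ip y z"
    and ip_smult_left: "\<lbrakk>x \<in> carrier X; y \<in> carrier X\<rbrakk> \<Longrightarrow> ip (c \<odot> x) y = c * ip x y"
    and ip_commute: "\<lbrakk>x \<in> carrier X; y \<in> carrier X\<rbrakk> \<Longrightarrow> ip y x = cnj (ip x y)"
    and ip_self: "x \<in> carrier X \<Longrightarrow> ip x x = complex_of_real ((nrm X x)\<^sup>2)"

text \<open>
  Operators are extensional functions (\<open>undefined\<close> outside the carrier of the domain), so that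
  equality of operators is equality of HOL functions and composition is \<open>compose\<close>.
\<close>

definition bounded_ops :: "'u cnormed \<Rightarrow> 'u cnormed \<Rightarrow> ('u \<Rightarrow> 'u) set" where
  "bounded_ops X Y = {S \<in> carrier X \<rightarrow>\<^sub>E carrier Y.
     (\<forall>x\<in>carrier X. \<forall>y\<in>carrier X. S (x \<oplus>\<^bsub>X\<^esub> y) = S x \<oplus>\<^bsub>Y\<^esub> S y) \<and>
     (\<forall>c. \<forall>x\<in>carrier X. S (c \<odot>\<^bsub>X\<^esub> x) = c \<odot>\<^bsub>Y\<^esub> S x) \<and>
     (\<exists>K. \<forall>x\<in>carrier X. nrm Y (S x) \<le> K * nrm X x)}"

definition op_norm :: "'u cnormed \<Rightarrow> 'u cnormed \<Rightarrow> ('u \<Rightarrow> 'u) \<Rightarrow> real" where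
  "op_norm X Y S = (SUP x\<in>{x \<in> carrier X. nrm X x \<le> 1}. nrm Y (S x))"

definition op_add :: "'u cnormed \<Rightarrow> 'u cnormed \<Rightarrow> ('u \<Rightarrow> 'u) \<Rightarrow> ('u \<Rightarrow> 'u) \<Rightarrow> 'u \<Rightarrow> 'u" where
  "op_add X Y S R = (\<lambda>x\<in>carrier X. S x \<oplus>\<^bsub>Y\<^esub> R x)"

definition op_id :: "'u cnormed \<Rightarrow> 'u \<Rightarrow> 'u" where
  "op_id X = (\<lambda>x\<in>carrier X. x)"

definition lin_comb :: "'u cnormed \<Rightarrow> 'u set \<Rightarrow> ('u \<Rightarrow> complex) \<Rightarrow> 'u" where
  "lin_comb X B c = (\<Oplus>\<^bsub>X\<^esub>b\<in>B. c b \<odot>\<^bsub>X\<^esub> b)"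

definition finite_basis :: "'u cnormed \<Rightarrow> 'u set \<Rightarrow> 'u set \<Rightarrow> bool" where
  "finite_basis X V B \<longleftrightarrow> finite B \<and> B \<subseteq> carrier X \<and>
     (\<forall>c. lin_comb X B c = \<zero>\<^bsub>X\<^esub> \<longrightarrow> (\<forall>b\<in>B. c b = 0)) \<and>
     V = range (lin_comb X B)"

definition rank_less :: "'u cnormed \<Rightarrow> 'u cnormed \<Rightarrow> ('u \<Rightarrow> 'u) \<Rightarrow> nat \<Rightarrow> bool" where
  "rank_less X Y S k \<longleftrightarrow> (\<exists>B. finite_basis Y (S ` carrier X) B \<and> card B < k)"

text \<open>
  \<open>X\<close> is a copy of \<open>k\<close>-dimensional complex Hilbert space: there is a linear isometry \<open>\<phi>\<close> from \<open>X\<close>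
  onto the space of \<open>k\<close>-tuples \<open>{..<k} \<rightarrow>\<^sub>E UNIV\<close> with the Euclidean norm.
\<close>

definition is_ell2 :: "nat \<Rightarrow> 'u cnormed \<Rightarrow> bool" where
  "is_ell2 k X \<longleftrightarrow> cbanach_space X \<and>
     (\<exists>\<phi> :: 'u \<Rightarrow> nat \<Rightarrow> complex. bij_betw \<phi> (carrier X) ({..<k} \<rightarrow>\<^sub>E UNIV) \<and>
       (\<forall>x\<in>carrier X. \<forall>y\<in>carrier X. \<forall>i<k. \<phi> (x \<oplus>\<^bsub>X\<^esub> y) i = \<phi> x i + \<phi> y i) \<and>
       (\<forall>c. \<forall>x\<in>carrier X. \<forall>i<k. \<phi> (c \<odot>\<^bsub>X\<^esub> x) i = c * \<phi> x i) \<and>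
       (\<forall>x\<in>carrier X. nrm X x = sqrt (\<Sum>i<k. (cmod (\<phi> x i))\<^sup>2)))"

text \<open>
  \<open>s X Y S k\<close> is the \<open>k\<close>-th s-number of \<open>S\<close>, an operator from \<open>X\<close> to \<open>Y\<close>. Indices start at 1; the
  value at \<open>k = 0\<close> and the values on arguments that are not bounded operators between Banach
  spaces are unconstrained.
\<close>

locale s_number_function =
  fixes s :: "'u cnormed \<Rightarrow> 'u cnormed \<Rightarrow> ('u \<Rightarrow> 'u) \<Rightarrow> nat \<Rightarrow> real"
  assumes s_1: "\<lbrakk>cbanach_space X; cbanach_space Y; S \<in> bounded_ops X Y\<rbrakk>
            \<Longrightarrow> s X Y S 1 = op_norm X Y S"
    and s_decreasing: "\<lbrakk>cbanach_space X; cbanach_space Y; S \<in> bounded_ops X Y; 1 \<le> k\<rbrakk>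
            \<Longrightarrow> s X Y S (Suc k) \<le> s X Y S k"
    and s_nonneg: "\<lbrakk>cbanach_space X; cbanach_space Y; S \<in> bounded_ops X Y; 1 \<le> k\<rbrakk>
            \<Longrightarrow> 0 \<le> s X Y S k"
    and s_add: "\<lbrakk>cbanach_space X; cbanach_space Y; S \<in> bounded_ops X Y; R \<in> bounded_ops X Y; 1 \<le> k\<rbrakk>
            \<Longrightarrow> s X Y (op_add X Y S R) k \<le> s X Y S k + op_norm X Y R"
    and s_compose: "\<lbrakk>cbanach_space X0; cbanach_space X; cbanach_space Y; cbanach_space Y0;
              V \<in> bounded_ops X0 X; S \<in> bounded_ops X Y; U \<in> bounded_ops Y Y0; 1 \<le> k\<rbrakk>
            \<Longrightarrow> s X0 Y0 (compose (carrier X0) U (compose (carrier X0) S V)) k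
                \<le> op_norm Y Y0 U * s X Y S k * op_norm X0 X V"
    and s_rank: "\<lbrakk>cbanach_space X; cbanach_space Y; S \<in> bounded_ops X Y; 1 \<le> k; rank_less X Y S k\<rbrakk>
            \<Longrightarrow> s X Y S k = 0"
    and s_ell2: "\<lbrakk>1 \<le> k; is_ell2 k X\<rbrakk> \<Longrightarrow> s X X (op_id X) k = 1"

text \<open>
  Weak* convergence of operators from \<open>X\<close> into a Hilbert space \<open>Y\<close> with inner product \<open>ip\<close>, where
  \<open>Y\<close> is identified with a dual space through its inner product.
\<close>

definition weak_star_tendsto ::
  "'u cnormed \<Rightarrow> 'u cnormed \<Rightarrow> ('u \<Rightarrow> 'u \<Rightarrow> complex) \<Rightarrow> (nat \<Rightarrow> 'u \<Rightarrow> 'u) \<Rightarrow> ('u \<Rightarrow> 'u) \<Rightarrow> bool" where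
  "weak_star_tendsto X Y ip Tn T \<longleftrightarrow>
     (\<forall>x\<in>carrier X. \<forall>y\<in>carrier Y. (\<lambda>n. ip (Tn n x) y) \<longlonglongrightarrow> ip (T x) y)"

end

theory Submission
  imports Defs
begin

text \<open>
  The estimate \<open>s\<^sub>k(T\<^sub>n) \<le> s\<^sub>k(T)\<close> is the ideal property (3). For the lower bound let
  \<open>\<sigma> = s\<^sub>k(T) > 0\<close>. If \<open>p\<close> is an orthogonal projection of rank less than \<open>k\<close>, then \<open>Tp\<close> has rank
  less than \<open>k\<close>, so \<open>\<sigma> \<le> \<parallel>T(1 - p)\<parallel>\<close> by (2) and (4). Hence one can choose orthonormal
  \<open>x\<^sub>1, \<dots>, x\<^sub>k\<close> one after the other, each nearly maximizing \<open>\<parallel>Tx\<parallel>\<close> on the orthogonal complement of the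
  preceding ones, with \<open>\<parallel>Tx\<^sub>j\<parallel> \<ge> \<sigma> - \<eta>\<close>; near-maximality makes the vectors \<open>Tx\<^sub>j\<close> almost orthogonal.
  So \<open>U y = \<Sum>\<^sub>j \<langle>y, Tx\<^sub>j\<rangle> x\<^sub>j / \<parallel>Tx\<^sub>j\<parallel>\<^sup>2\<close> has norm about \<open>1/\<sigma>\<close>, and by weak* convergence \<open>U T\<^sub>n\<close>,
  restricted to the span of the \<open>x\<^sub>j\<close>, is close to the identity of a \<open>k\<close>-dimensional Hilbert space.
  By (5), (2) and (3), \<open>1 - \<epsilon> \<le> \<parallel>U\<parallel> s\<^sub>k(T\<^sub>n)\<close>.
\<close>

subsection \<open>Coordinate copies of finite-dimensional Hilbert space\<close>

lemma complex_ring_simps [simp]: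
  "carrier complex_ring = UNIV"
  "a \<oplus>\<^bsub>complex_ring\<^esub> b = a + b"
  "a \<otimes>\<^bsub>complex_ring\<^esub> b = a * b"
  "\<zero>\<^bsub>complex_ring\<^esub> = 0"
  "\<one>\<^bsub>complex_ring\<^esub> = 1"
  by (simp_all add: complex_ring_def)

lemma cring_complex_ring: "cring complex_ring"
proof (rule cringI)
  show "abelian_group complex_ring"
    by (rule abelian_groupI) (auto simp: algebra_simps intro: exI[of _ "- _"] add.left_inverse)
  show "Group.comm_monoid complex_ring"
    by (rule comm_monoidI) auto
qed (auto simp: algebra_simps)

text \<open>Axiom (5) speaks only of spaces carried by \<open>'u\<close>, so a k-dimensional Hilbert
  space has to be laid on a subset \<open>A\<close> of that type. All operations are carried out on
  coordinates and transported back by the inverse of \<open>\<phi>\<close>; \<open>restrict\<close>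
  is there because the coordinate tuples are extensional functions.\<close>

definition ell2_on :: "nat \<Rightarrow> 'u set \<Rightarrow> ('u \<Rightarrow> nat \<Rightarrow> complex) \<Rightarrow> 'u cnormed" where
  "ell2_on k A \<phi> =
    (let \<psi> = \<lambda>c. inv_into A \<phi> (restrict c {..<k});
         \<phi>0 = \<lambda>x i. if x \<in> A then \<phi> x i else 0
     in \<lparr>carrier = A, monoid.mult = (\<lambda>x y. x), one = \<psi> (\<lambda>i. 0), ring.zero = \<psi> (\<lambda>i. 0),
         add = (\<lambda>x y. \<psi> (\<lambda>i. \<phi>0 x i + \<phi>0 y i)), smult = (\<lambda>c x. \<psi> (\<lambda>i. c * \<phi>0 x i)),
         nrm = (\<lambda>x. sqrt (\<Sum>i<k. (cmod (\<phi>0 x i))\<^sup>2))\<rparr>)"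

locale ell2_coordinates =
  fixes k :: nat and A :: "'u set" and \<phi> :: "'u \<Rightarrow> nat \<Rightarrow> complex"
  assumes bij: "bij_betw \<phi> A ({..<k} \<rightarrow>\<^sub>E UNIV)"
begin

definition \<psi> :: "(nat \<Rightarrow> complex) \<Rightarrow> 'u" where "\<psi> c = inv_into A \<phi> (restrict c {..<k})"

definition \<phi>0 :: "'u \<Rightarrow> nat \<Rightarrow> complex" where "\<phi>0 x i = (if x \<in> A then \<phi> x i else 0)"

abbreviation E where "E \<equiv> ell2_on k A \<phi>"

lemma carrier_E [simp]: "carrier E = A"
  and zero_E: "\<zero>\<^bsub>E\<^esub> = \<psi> (\<lambda>i. 0)"
  and add_E: "x \<oplus>\<^bsub>E\<^esub> y = \<psi> (\<lambda>i. \<phi>0 x i + \<phi>0 y i)"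
  and smult_E: "c \<odot>\<^bsub>E\<^esub> x = \<psi> (\<lambda>i. c * \<phi>0 x i)"
  and nrm_E: "nrm E x = sqrt (\<Sum>i<k. (cmod (\<phi>0 x i))\<^sup>2)"
  by (simp_all add: ell2_on_def Let_def \<psi>_def \<phi>0_def)

lemma restrict_in_range: "restrict c {..<k} \<in> \<phi> ` A"
proof -
  have "\<phi> ` A = {..<k} \<rightarrow>\<^sub>E UNIV" using bij by (simp add: bij_betw_def)
  then show ?thesis by simp
qed

lemma \<psi>_in [simp]: "\<psi> c \<in> A"
  unfolding \<psi>_def by (rule inv_into_into[OF restrict_in_range])

lemma \<phi>_\<psi> [simp]: "i < k \<Longrightarrow> \<phi> (\<psi> c) i = c i"
  unfolding \<psi>_def by (subst f_inv_into_f[OF restrict_in_range]) simp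

lemma \<phi>0_\<psi> [simp]: "i < k \<Longrightarrow> \<phi>0 (\<psi> c) i = c i"
  by (simp add: \<phi>0_def)

lemma \<phi>0_in: "x \<in> A \<Longrightarrow> \<phi>0 x = \<phi> x"
  by (auto simp: \<phi>0_def)

lemma coord_eqI:
  assumes "x \<in> A" "y \<in> A" "\<And>i. i < k \<Longrightarrow> \<phi>0 x i = \<phi>0 y i"
  shows "x = y"
proof -
  have "\<phi> x \<in> {..<k} \<rightarrow>\<^sub>E UNIV" "\<phi> y \<in> {..<k} \<rightarrow>\<^sub>E UNIV"
    using bij assms(1,2) by (auto simp: bij_betw_def)
  then have "\<phi> x = \<phi> y"
    using assms by (intro PiE_ext) (auto simp: \<phi>0_in)
  then show ?thesis
    using bij assms(1,2) by (auto simp: bij_betw_def inj_on_def)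
qed

lemma abelian_group_E: "abelian_group E"
proof (rule abelian_groupI)
  fix x assume x: "x \<in> carrier E"
  show "\<exists>y\<in>carrier E. y \<oplus>\<^bsub>E\<^esub> x = \<zero>\<^bsub>E\<^esub>"
    by (rule bexI[of _ "\<psi> (\<lambda>i. - \<phi>0 x i)"]) (auto simp: add_E zero_E intro!: coord_eqI)
qed (auto simp: add_E zero_E intro!: coord_eqI)

lemma module_E: "Module.module complex_ring E"
  by (rule moduleI[OF cring_complex_ring abelian_group_E])
     (auto simp: add_E smult_E algebra_simps intro!: coord_eqI)

text \<open>
  The locale \<open>Metric_space\<close> requires a distance that is symmetric and nonnegative on the whole type.
  This is why \<open>ell2_on\<close> gives points outside \<open>A\<close> the coordinates 0 instead of inheriting the
  operations of an ambient space: the following holds without assumptions on \<open>x\<close> and \<open>y\<close>.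
\<close>

lemma nrm_minus_E: "nrm E (x \<ominus>\<^bsub>E\<^esub> y) = sqrt (\<Sum>i<k. (cmod (\<phi>0 x i - \<phi>0 y i))\<^sup>2)"
proof -
  have inv: "\<ominus>\<^bsub>E\<^esub> y = \<psi> (\<lambda>i. - \<phi>0 y i)"
    unfolding a_inv_def m_inv_def
  proof (rule the_equality)
    fix z assume z: "z \<in> carrier (add_monoid E) \<and>
      y \<otimes>\<^bsub>add_monoid E\<^esub> z = \<one>\<^bsub>add_monoid E\<^esub> \<and> z \<otimes>\<^bsub>add_monoid E\<^esub> y = \<one>\<^bsub>add_monoid E\<^esub>"
    then have "\<phi>0 (y \<oplus>\<^bsub>E\<^esub> z) i = \<phi>0 \<zero>\<^bsub>E\<^esub> i" for i by simp
    then have "\<phi>0 y i + \<phi>0 z i = 0" if "i < k" for i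
      using that by (metis (no_types, lifting) \<phi>0_\<psi> add_E zero_E)
    then show "z = \<psi> (\<lambda>i. - \<phi>0 y i)"
      using z by (intro coord_eqI) (auto simp: eq_neg_iff_add_eq_0 add.commute)
  qed (auto simp: add_E zero_E intro!: coord_eqI)
  show ?thesis
    by (simp add: a_minus_def inv add_E nrm_E)
qed

lemma nrm_E_L2: "nrm E x = L2_set (\<lambda>i. cmod (\<phi>0 x i)) {..<k}"
  by (simp add: nrm_E L2_set_def)

lemma cnormed_space_E: "cnormed_space E"
proof (intro cnormed_space.intro module_E cnormed_space_axioms.intro)
  fix x assume x: "x \<in> carrier E" "nrm E x = 0"
  then have "(\<Sum>i<k. (cmod (\<phi>0 x i))\<^sup>2) = 0" by (simp add: nrm_E)
  then have "\<forall>i<k. \<phi>0 x i = 0" by (subst (asm) sum_nonneg_eq_0_iff) auto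
  then show "x = \<zero>\<^bsub>E\<^esub>" using x by (auto simp: zero_E intro!: coord_eqI)
next
  fix x c assume "x \<in> carrier E"
  have "(\<Sum>i<k. (cmod (c * \<phi>0 x i))\<^sup>2) = (cmod c)\<^sup>2 * (\<Sum>i<k. (cmod (\<phi>0 x i))\<^sup>2)"
    by (simp add: norm_mult power_mult_distrib sum_distrib_left)
  then show "nrm E (c \<odot>\<^bsub>E\<^esub> x) = cmod c * nrm E x"
    by (simp add: nrm_E smult_E real_sqrt_mult)
next
  fix x y assume "x \<in> carrier E" "y \<in> carrier E"
  have "nrm E (x \<oplus>\<^bsub>E\<^esub> y) \<le> L2_set (\<lambda>i. cmod (\<phi>0 x i) + cmod (\<phi>0 y i)) {..<k}"
    unfolding nrm_E_L2 by (rule L2_set_mono) (auto simp: add_E norm_triangle_ineq)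
  also have "\<dots> \<le> nrm E x + nrm E y"
    unfolding nrm_E_L2 by (rule L2_set_triangle_ineq)
  finally show "nrm E (x \<oplus>\<^bsub>E\<^esub> y) \<le> nrm E x + nrm E y" .
qed (simp add: nrm_E sum_nonneg)

text \<open>A Cauchy sequence is Cauchy in each of the finitely many coordinates, and the
  coordinatewise limits, assembled by \<open>\<psi>\<close>, form its limit in norm.\<close>

lemma mcomplete_E: "Metric_space.mcomplete (carrier E) (\<lambda>x y. nrm E (x \<ominus>\<^bsub>E\<^esub> y))"
proof -
  let ?d = "\<lambda>x y. nrm E (x \<ominus>\<^bsub>E\<^esub> y)"
  have d: "?d x y = L2_set (\<lambda>i. cmod (\<phi>0 x i - \<phi>0 y i)) {..<k}" for x y
    by (simp add: nrm_minus_E L2_set_def)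
  interpret Metric_space A ?d
  proof
    fix x y assume "x \<in> A" "y \<in> A"
    then show "(?d x y = 0) = (x = y)"
      by (auto simp: d L2_set_eq_0_iff intro!: coord_eqI)
  next
    fix x y z
    have "?d x z \<le> L2_set (\<lambda>i. cmod (\<phi>0 x i - \<phi>0 y i) + cmod (\<phi>0 y i - \<phi>0 z i)) {..<k}"
      unfolding d by (rule L2_set_mono) (use norm_diff_triangle_le in blast, simp)
    also have "\<dots> \<le> ?d x y + ?d y z"
      unfolding d by (rule L2_set_triangle_ineq)
    finally show "?d x z \<le> ?d x y + ?d y z" .
  qed (simp_all add: d norm_minus_commute)
  show ?thesis
    unfolding carrier_E mcomplete_def
  proof (intro allI impI)
    fix \<sigma> assume \<sigma>: "MCauchy \<sigma>"
    have "\<exists>c. (\<lambda>n. \<phi>0 (\<sigma> n) i) \<longlonglongrightarrow> c" if i: "i < k" for i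
    proof -
      have "cmod (\<phi>0 (\<sigma> m) i - \<phi>0 (\<sigma> n) i) \<le> ?d (\<sigma> m) (\<sigma> n)" for m n
        unfolding d using i by (intro member_le_L2_set) auto
      then have "Cauchy (\<lambda>n. \<phi>0 (\<sigma> n) i)"
        using \<sigma> unfolding MCauchy_def Cauchy_def dist_norm by (meson order_le_less_trans)
      then show ?thesis by (simp add: Cauchy_convergent_iff convergent_def)
    qed
    then obtain c where c: "\<And>i. i < k \<Longrightarrow> (\<lambda>n. \<phi>0 (\<sigma> n) i) \<longlonglongrightarrow> c i" by metis
    \<comment> \<open>The distance is a continuous function of the coordinates, so it tends to the
      square root of a sum of zeros.\<close>
    have "(\<lambda>n. ?d (\<sigma> n) (\<psi> c)) \<longlonglongrightarrow> sqrt (\<Sum>i<k. (cmod (c i - c i))\<^sup>2)"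
      unfolding nrm_minus_E by (intro tendsto_intros) (auto intro: c)
    then show "\<exists>x. limitin mtopology \<sigma> x sequentially"
      using \<sigma> by (intro exI[of _ "\<psi> c"]) (auto simp: limitin_metric_dist_null MCauchy_def image_subset_iff)
  qed
qed

lemma cbanach_space_E: "cbanach_space E"
  by (intro cbanach_space.intro cnormed_space_E cbanach_space_axioms.intro mcomplete_E)

lemma is_ell2_E: "is_ell2 k E"
  unfolding is_ell2_def
  by (intro conjI cbanach_space_E exI[of _ \<phi>])
     (auto simp: bij add_E smult_E nrm_E \<phi>0_in)

end

subsection \<open>Normed spaces and bounded operators\<close>

text \<open>\<open>lin_comb\<close> sums over a set of vectors. Families such as T x_i may repeat a
  vector, so sums over an index set are needed as well.\<close>

definition lincomb :: "'u cnormed \<Rightarrow> 'i set \<Rightarrow> ('i \<Rightarrow> complex) \<Rightarrow> ('i \<Rightarrow> 'u) \<Rightarrow> 'u" where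
  "lincomb X J c f = (\<Oplus>\<^bsub>X\<^esub>j\<in>J. c j \<odot>\<^bsub>X\<^esub> f j)"

lemma lin_comb_eq_lincomb: "lin_comb X B c = lincomb X B c (\<lambda>b. b)"
  by (simp add: lin_comb_def lincomb_def)

context cnormed_space
begin

lemma smult_in [simp]: "x \<in> carrier X \<Longrightarrow> c \<odot> x \<in> carrier X"
  by (rule smult_closed) auto

lemma smult_add_left: "x \<in> carrier X \<Longrightarrow> (a + b) \<odot> x = a \<odot> x \<oplus> b \<odot> x"
  using smult_l_distr[of a b x] by simp

lemma smult_smult: "x \<in> carrier X \<Longrightarrow> a \<odot> (b \<odot> x) = (a * b) \<odot> x"
  using smult_assoc1[of a b x] by simp

lemma smult_1 [simp]: "x \<in> carrier X \<Longrightarrow> 1 \<odot> x = x"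
  using smult_one[of x] by simp

lemma smult_0 [simp]: "x \<in> carrier X \<Longrightarrow> 0 \<odot> x = \<zero>"
  using smult_l_null[of x] by simp

lemma nrm_0 [simp]: "nrm X \<zero> = 0"
  using nrm_smult[of \<zero> 0] by simp

lemma uminus_eq_smult: "x \<in> carrier X \<Longrightarrow> \<ominus> x = (-1) \<odot> x"
proof -
  assume x: "x \<in> carrier X"
  then have "(-1) \<odot> x \<oplus> x = \<zero>"
    using smult_add_left[of x "-1" 1] by simp
  then show ?thesis using x by (simp add: minus_equality)
qed

lemma lincomb_empty [simp]: "lincomb X {} c f = \<zero>"
  by (simp add: lincomb_def)

lemma lincomb_insert:
  assumes "finite J" "j \<notin> J" "f j \<in> carrier X" "\<And>i. i \<in> J \<Longrightarrow> f i \<in> carrier X"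
  shows "lincomb X (insert j J) c f = c j \<odot> f j \<oplus> lincomb X J c f"
  using assms unfolding lincomb_def by (intro finsum_insert) auto

lemma lincomb_closed [simp]:
  "(\<And>i. i \<in> J \<Longrightarrow> f i \<in> carrier X) \<Longrightarrow> lincomb X J c f \<in> carrier X"
  unfolding lincomb_def by (intro finsum_closed) auto

lemma lincomb_cong:
  assumes "\<And>i. i \<in> J \<Longrightarrow> c i = d i" "\<And>i. i \<in> J \<Longrightarrow> f i \<in> carrier X"
  shows "lincomb X J c f = lincomb X J d f"
  using assms unfolding lincomb_def by (intro finsum_cong') auto

lemma bounded_opsD:
  assumes "S \<in> bounded_ops Y X"
  shows "x \<in> carrier Y \<Longrightarrow> S x \<in> carrier X"
    and "x \<in> carrier Y \<Longrightarrow> y \<in> carrier Y \<Longrightarrow> S (x \<oplus>\<^bsub>Y\<^esub> y) = S x \<oplus> S y"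
    and "x \<in> carrier Y \<Longrightarrow> S (c \<odot>\<^bsub>Y\<^esub> x) = c \<odot> S x"
    and "S \<in> extensional (carrier Y)"
  using assms by (auto simp: bounded_ops_def PiE_def)

end

lemma bounded_opsI:
  assumes "\<And>x. x \<in> carrier X \<Longrightarrow> S x \<in> carrier Y" "S \<in> extensional (carrier X)"
    and "\<And>x y. x \<in> carrier X \<Longrightarrow> y \<in> carrier X \<Longrightarrow> S (x \<oplus>\<^bsub>X\<^esub> y) = S x \<oplus>\<^bsub>Y\<^esub> S y"
    and "\<And>c x. x \<in> carrier X \<Longrightarrow> S (c \<odot>\<^bsub>X\<^esub> x) = c \<odot>\<^bsub>Y\<^esub> S x"
    and "\<And>x. x \<in> carrier X \<Longrightarrow> nrm Y (S x) \<le> K * nrm X x"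
  shows "S \<in> bounded_ops X Y"
  using assms unfolding bounded_ops_def by (auto simp: PiE_def intro!: exI[of _ K])

section \<open>Linearity and operator norm estimates\<close>

locale cnormed_pair = X: cnormed_space X + Y: cnormed_space Y for X Y :: "'u cnormed"
begin

lemma op_zero: "S \<in> bounded_ops X Y \<Longrightarrow> S \<zero>\<^bsub>X\<^esub> = \<zero>\<^bsub>Y\<^esub>"
  using Y.bounded_opsD(3)[of S X "\<zero>\<^bsub>X\<^esub>" 0] Y.bounded_opsD(1)[of S X "\<zero>\<^bsub>X\<^esub>"] by simp

lemma op_lincomb:
  assumes S: "S \<in> bounded_ops X Y" and "finite J" and "\<And>j. j \<in> J \<Longrightarrow> f j \<in> carrier X"
  shows "S (lincomb X J c f) = lincomb Y J c (\<lambda>j. S (f j))"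
  using assms(2,3)
  by (induction J rule: finite_induct)
     (simp_all add: op_zero[OF S] X.lincomb_insert Y.lincomb_insert Y.bounded_opsD[OF S])

lemma bdd_above_nrm:
  assumes "S \<in> bounded_ops X Y"
  shows "bdd_above ((\<lambda>x. nrm Y (S x)) ` {x \<in> carrier X. nrm X x \<le> 1})"
proof -
  obtain K where K: "\<And>x. x \<in> carrier X \<Longrightarrow> nrm Y (S x) \<le> K * nrm X x"
    using assms unfolding bounded_ops_def by blast
  show ?thesis
  proof (rule bdd_aboveI2)
    fix x assume x: "x \<in> {x \<in> carrier X. nrm X x \<le> 1}"
    then have "nrm Y (S x) \<le> K * nrm X x" using K by blast
    also have "\<dots> \<le> \<bar>K\<bar> * 1" using x X.nrm_nonneg[of x] by (intro mult_mono) auto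
    finally show "nrm Y (S x) \<le> \<bar>K\<bar>" by simp
  qed
qed

lemma op_norm_bound:
  assumes S: "S \<in> bounded_ops X Y" and x: "x \<in> carrier X"
  shows "nrm Y (S x) \<le> op_norm X Y S * nrm X x"
proof (cases "nrm X x = 0")
  case True
  then have "x = \<zero>\<^bsub>X\<^esub>" using x X.nrm_eq_0_imp by blast
  then show ?thesis by (simp add: op_zero[OF S])
next
  case False
  then have pos: "nrm X x > 0" using X.nrm_nonneg[OF x] by simp
  let ?u = "complex_of_real (inverse (nrm X x)) \<odot>\<^bsub>X\<^esub> x"
  have c: "cmod (complex_of_real (inverse (nrm X x))) = inverse (nrm X x)"
    using pos by (simp only: norm_of_real abs_of_pos positive_imp_inverse_positive)
  have "nrm X ?u = 1"
    using pos x by (simp add: X.nrm_smult c del: of_real_inverse)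
  then have "nrm Y (S ?u) \<le> op_norm X Y S"
    unfolding op_norm_def using x by (intro cSUP_upper bdd_above_nrm[OF S]) auto
  then have "inverse (nrm X x) * nrm Y (S x) \<le> op_norm X Y S"
    using x pos by (simp add: Y.bounded_opsD[OF S] Y.nrm_smult c del: of_real_inverse)
  then show ?thesis
    using pos by (simp add: field_simps)
qed

lemma op_norm_le:
  assumes "\<And>x. x \<in> carrier X \<Longrightarrow> nrm Y (S x) \<le> K * nrm X x" "0 \<le> K"
  shows "op_norm X Y S \<le> K"
  unfolding op_norm_def
proof (rule cSUP_least)
  show "{x \<in> carrier X. nrm X x \<le> 1} \<noteq> {}" using X.nrm_0 by (auto intro!: exI[of _ "\<zero>\<^bsub>X\<^esub>"])
  fix x assume "x \<in> {x \<in> carrier X. nrm X x \<le> 1}"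
  then show "nrm Y (S x) \<le> K"
    using assms(1)[of x] mult_left_mono[of "nrm X x" 1 K] assms(2) by auto
qed

lemma op_norm_nonneg:
  assumes "S \<in> bounded_ops X Y"
  shows "0 \<le> op_norm X Y S"
proof -
  have "nrm Y (S \<zero>\<^bsub>X\<^esub>) \<le> op_norm X Y S"
    unfolding op_norm_def by (intro cSUP_upper bdd_above_nrm[OF assms]) auto
  then show ?thesis by (simp add: op_zero[OF assms])
qed

end

lemma bounded_ops_compose:
  assumes "cnormed_space X" "cnormed_space Y" "cnormed_space Z"
    and S: "S \<in> bounded_ops X Y" and R: "R \<in> bounded_ops Y Z"
  shows "compose (carrier X) R S \<in> bounded_ops X Z"
proof -
  interpret X: cnormed_space X by fact
  interpret XY: cnormed_pair X Y by (intro cnormed_pair.intro assms)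
  interpret YZ: cnormed_pair Y Z by (intro cnormed_pair.intro assms)
  show ?thesis
  proof (rule bounded_opsI[where K = "op_norm Y Z R * op_norm X Y S"])
    fix x assume x: "x \<in> carrier X"
    have "nrm Z (R (S x)) \<le> op_norm Y Z R * nrm Y (S x)"
      using x by (intro YZ.op_norm_bound[OF R] XY.Y.bounded_opsD[OF S])
    also have "\<dots> \<le> op_norm Y Z R * (op_norm X Y S * nrm X x)"
      by (intro mult_left_mono XY.op_norm_bound[OF S] x YZ.op_norm_nonneg[OF R])
    finally show "nrm Z (compose (carrier X) R S x) \<le> op_norm Y Z R * op_norm X Y S * nrm X x"
      using x by (simp add: compose_eq mult.assoc)
  qed (auto simp: compose_eq XY.Y.bounded_opsD[OF S] YZ.Y.bounded_opsD[OF R])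
qed

subsection \<open>Geometry of Hilbert spaces\<close>

lemma sum_squared_le_card:
  fixes a :: "nat \<Rightarrow> real"
  shows "(\<Sum>i<k. a i)\<^sup>2 \<le> k * (\<Sum>i<k. (a i)\<^sup>2)"
  using Cauchy_Schwarz_ineq_sum[of a "\<lambda>_. 1" "{..<k}"] by (simp add: mult.commute)

context chilbert_space
begin

lemma ip_0_left [simp]: "z \<in> carrier X \<Longrightarrow> ip \<zero> z = 0"
  using ip_smult_left[of \<zero> z 0] by simp

lemma ip_add_right:
  "x \<in> carrier X \<Longrightarrow> y \<in> carrier X \<Longrightarrow> z \<in> carrier X \<Longrightarrow> ip z (x \<oplus> y) = ip z x + ip z y"
  by (simp add: ip_commute[of _ z] ip_add_left)

lemma ip_smult_right:
  "x \<in> carrier X \<Longrightarrow> z \<in> carrier X \<Longrightarrow> ip z (c \<odot> x) = cnj c * ip z x"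
  by (simp add: ip_commute[of _ z] ip_smult_left)

lemma ip_0_right [simp]: "z \<in> carrier X \<Longrightarrow> ip z \<zero> = 0"
  using ip_commute[of \<zero> z] by simp

lemma ip_minus_left:
  "x \<in> carrier X \<Longrightarrow> y \<in> carrier X \<Longrightarrow> z \<in> carrier X \<Longrightarrow> ip (x \<ominus> y) z = ip x z - ip y z"
  by (simp add: a_minus_def uminus_eq_smult ip_add_left ip_smult_left)

lemma ip_minus_right:
  "x \<in> carrier X \<Longrightarrow> y \<in> carrier X \<Longrightarrow> z \<in> carrier X \<Longrightarrow> ip z (x \<ominus> y) = ip z x - ip z y"
  by (simp add: a_minus_def uminus_eq_smult ip_add_right ip_smult_right)

lemma nrm_sq: "x \<in> carrier X \<Longrightarrow> (nrm X x)\<^sup>2 = Re (ip x x)"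
  by (simp add: ip_self)

text \<open>Testing against all z turns vector identities into identities of complex numbers. The
  algebra of \<open>proj\<close> and \<open>coproj\<close> is handled this way instead of by module
  calculations.\<close>

lemma ip_eqI:
  assumes x: "x \<in> carrier X" and y: "y \<in> carrier X"
    and eq: "\<And>z. z \<in> carrier X \<Longrightarrow> ip x z = ip y z"
  shows "x = y"
proof -
  have "ip (x \<ominus> y) (x \<ominus> y) = 0"
    using x y eq[of "x \<ominus> y"] by (simp add: ip_minus_left)
  then have "nrm X (x \<ominus> y) = 0"
    using nrm_sq[of "x \<ominus> y"] x y by simp
  then have "x \<ominus> y = \<zero>" using nrm_eq_0_imp x y by simp
  then show ?thesis using x y minus_equality[of x "\<ominus> y"] by (simp add: a_minus_def)
qed

lemma ip_lincomb_left:
  assumes "finite J" "\<And>j. j \<in> J \<Longrightarrow> f j \<in> carrier X" "z \<in> carrier X"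
  shows "ip (lincomb X J c f) z = (\<Sum>j\<in>J. c j * ip (f j) z)"
  using assms
  by (induction J rule: finite_induct) (simp_all add: lincomb_insert ip_add_left ip_smult_left)

lemma ip_lincomb_right:
  assumes "finite J" "\<And>j. j \<in> J \<Longrightarrow> f j \<in> carrier X" "z \<in> carrier X"
  shows "ip z (lincomb X J c f) = (\<Sum>j\<in>J. cnj (c j) * ip z (f j))"
  using assms
  by (induction J rule: finite_induct) (simp_all add: lincomb_insert ip_add_right ip_smult_right)

definition orthonormal :: "nat \<Rightarrow> (nat \<Rightarrow> 'u) \<Rightarrow> bool" where
  "orthonormal m x \<longleftrightarrow> (\<forall>i<m. x i \<in> carrier X) \<and>
     (\<forall>i<m. \<forall>j<m. ip (x i) (x j) = (if i = j then 1 else 0))"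

lemma nrm_lincomb_orthonormal:
  assumes "orthonormal m x"
  shows "(nrm X (lincomb X {..<m} c x))\<^sup>2 = (\<Sum>i<m. (cmod (c i))\<^sup>2)"
proof -
  let ?v = "lincomb X {..<m} c x"
  have x: "x i \<in> carrier X" if "i < m" for i using assms that by (simp add: orthonormal_def)
  have v: "?v \<in> carrier X" using x by (intro lincomb_closed) simp
  have "ip ?v ?v = (\<Sum>i<m. c i * ip (x i) ?v)"
    using x v by (intro ip_lincomb_left) auto
  also have "\<dots> = (\<Sum>i<m. c i * cnj (c i))"
  proof (rule sum.cong[OF refl])
    fix i assume i: "i \<in> {..<m}"
    have "ip (x i) ?v = (\<Sum>j<m. cnj (c j) * ip (x i) (x j))"
      using x i by (intro ip_lincomb_right) auto
    also have "\<dots> = (\<Sum>j<m. if j = i then cnj (c j) else 0)"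
      using assms i by (intro sum.cong) (auto simp: orthonormal_def)
    finally show "c i * ip (x i) ?v = c i * cnj (c i)" using i by simp
  qed
  also have "\<dots> = complex_of_real (\<Sum>i<m. (cmod (c i))\<^sup>2)"
    by (simp only: of_real_sum complex_norm_square)
  finally show ?thesis
    using v by (simp add: nrm_sq)
qed

text \<open>Pythagoras: with p the projected vector, the products <v,p>, <p,v> and <p,p> all equal
  the sum of squared coefficients, so one copy of it survives with a minus sign.\<close>

lemma nrm_minus_proj:
  assumes x: "orthonormal m x" and v: "v \<in> carrier X"
  shows "(nrm X (v \<ominus> lincomb X {..<m} (\<lambda>i. ip v (x i)) x))\<^sup>2
    = (nrm X v)\<^sup>2 - (\<Sum>i<m. (cmod (ip v (x i)))\<^sup>2)"
proof -
  let ?p = "lincomb X {..<m} (\<lambda>i. ip v (x i)) x"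
  have c: "x i \<in> carrier X" if "i < m" for i using x that by (simp add: orthonormal_def)
  have p: "?p \<in> carrier X" using c by (intro lincomb_closed) simp
  have S: "complex_of_real (\<Sum>i<m. (cmod (ip v (x i)))\<^sup>2) = (\<Sum>i<m. ip v (x i) * cnj (ip v (x i)))"
    by (simp only: of_real_sum complex_norm_square)
  have vp: "ip v ?p = complex_of_real (\<Sum>i<m. (cmod (ip v (x i)))\<^sup>2)"
    unfolding S using c v by (subst ip_lincomb_right) (auto simp: mult.commute)
  have pv: "ip ?p v = complex_of_real (\<Sum>i<m. (cmod (ip v (x i)))\<^sup>2)"
    using ip_commute[OF v p] vp by simp
  have pp: "ip ?p ?p = complex_of_real (\<Sum>i<m. (cmod (ip v (x i)))\<^sup>2)"
    using ip_self[OF p] nrm_lincomb_orthonormal[OF x] by simp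
  have "ip (v \<ominus> ?p) (v \<ominus> ?p) = ip v v - ip v ?p - (ip ?p v - ip ?p ?p)"
    using v p by (simp add: ip_minus_left ip_minus_right)
  then have "Re (ip (v \<ominus> ?p) (v \<ominus> ?p)) = Re (ip v v) - (\<Sum>i<m. (cmod (ip v (x i)))\<^sup>2)"
    by (simp add: vp pv pp)
  then show ?thesis using v p by (simp add: nrm_sq)
qed

text \<open>This will bound the norm of the map sending v to the tuple of its products with the u_i.
  The Gram bound controls the adjoint: ||sum c_i u_i||^2 is at most K sum |c_i|^2 with K = a + k b.
  Taking c_i = <v,u_i> and expanding a nonnegative square carries the same K over to the
  coefficients.\<close>

lemma bessel_near_orthogonal:
  fixes k :: nat and a b :: real
  assumes u: "\<And>i. i < k \<Longrightarrow> u i \<in> carrier X"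
    and gram: "\<And>i j. i < k \<Longrightarrow> j < k \<Longrightarrow> cmod (ip (u i) (u j)) \<le> (if i = j then a else 0) + b"
    and b: "0 \<le> b" and pos: "0 < a + k * b" and v: "v \<in> carrier X"
  shows "(\<Sum>i<k. (cmod (ip v (u i)))\<^sup>2) \<le> (a + k * b) * (nrm X v)\<^sup>2"
proof -
  define c where "c i = ip v (u i)" for i
  define S where "S = (\<Sum>i<k. (cmod (c i))\<^sup>2)"
  define K where "K = a + k * b"
  \<comment> \<open>This t minimizes -2 t S + t^2 K S, the bound for the change of ||v||^2 when t w
    is subtracted from v.\<close>
  define t where "t = 1 / K"
  let ?w = "lincomb X {..<k} c u"
  have w: "?w \<in> carrier X" using u by (intro lincomb_closed) simp
  have Sc: "complex_of_real S = (\<Sum>i<k. c i * cnj (c i))"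
    by (simp only: S_def of_real_sum complex_norm_square)
  have vw: "ip v ?w = complex_of_real S"
    unfolding Sc using u v by (subst ip_lincomb_right) (auto simp: c_def mult.commute)
  have wv: "ip ?w v = complex_of_real S"
    using ip_commute[OF v w] vw by simp
  have "(nrm X ?w)\<^sup>2 \<le> cmod (ip ?w ?w)"
    using nrm_sq[OF w] complex_Re_le_cmod by simp
  also have "ip ?w ?w = (\<Sum>i<k. c i * (\<Sum>j<k. cnj (c j) * ip (u i) (u j)))"
  proof -
    have "ip ?w ?w = (\<Sum>i<k. c i * ip (u i) ?w)"
      using u w by (intro ip_lincomb_left) auto
    also have "\<dots> = (\<Sum>i<k. c i * (\<Sum>j<k. cnj (c j) * ip (u i) (u j)))"
      using u by (intro sum.cong arg_cong2[of _ _ _ _ "(*)"] ip_lincomb_right) auto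
    finally show ?thesis .
  qed
  also have "cmod \<dots> \<le> (\<Sum>i<k. cmod (c i) * (\<Sum>j<k. cmod (c j) * ((if i = j then a else 0) + b)))"
  proof (rule sum_norm_le)
    fix i assume i: "i \<in> {..<k}"
    have "cmod (\<Sum>j<k. cnj (c j) * ip (u i) (u j))
      \<le> (\<Sum>j<k. cmod (c j) * ((if i = j then a else 0) + b))"
    proof (rule sum_norm_le)
      fix j assume "j \<in> {..<k}"
      then show "cmod (cnj (c j) * ip (u i) (u j)) \<le> cmod (c j) * ((if i = j then a else 0) + b)"
        using i gram[of i j] by (simp add: norm_mult mult_left_mono)
    qed
    then show "cmod (c i * (\<Sum>j<k. cnj (c j) * ip (u i) (u j)))
      \<le> cmod (c i) * (\<Sum>j<k. cmod (c j) * ((if i = j then a else 0) + b))"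
      by (simp add: norm_mult mult_left_mono)
  qed
  \<comment> \<open>The diagonal part contributes a S. The uniform part b factors into a squared sum
    of moduli, which Cauchy-Schwarz bounds by k S.\<close>
  also have "\<dots> = a * S + b * (\<Sum>i<k. cmod (c i))\<^sup>2"
    by (simp add: S_def algebra_simps sum.distrib power2_eq_square sum_distrib_left sum_distrib_right
        if_distrib[of "\<lambda>u. _ * u"] cong: if_cong)
  also have "\<dots> \<le> a * S + b * (k * S)"
    unfolding S_def by (intro add_left_mono mult_left_mono sum_squared_le_card b)
  finally have ww: "(nrm X ?w)\<^sup>2 \<le> K * S" by (simp add: K_def algebra_simps)
  have "0 \<le> (nrm X (v \<ominus> complex_of_real t \<odot> ?w))\<^sup>2" by simp
  also have "\<dots> = (nrm X v)\<^sup>2 - 2 * t * S + t\<^sup>2 * (nrm X ?w)\<^sup>2"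
  proof -
    let ?d = "v \<ominus> complex_of_real t \<odot> ?w"
    have "ip ?d ?d = ip v v - 2 * complex_of_real (t * S) + complex_of_real (t\<^sup>2) * ip ?w ?w"
      using v w by (simp add: ip_minus_left ip_minus_right ip_smult_left ip_smult_right vw wv
          power2_eq_square algebra_simps)
    then have "Re (ip ?d ?d) = Re (ip v v) - 2 * (t * S) + t\<^sup>2 * Re (ip ?w ?w)"
      by (simp del: of_real_mult of_real_power)
    then show ?thesis using v w by (simp add: nrm_sq)
  qed
  also have "\<dots> \<le> (nrm X v)\<^sup>2 - 2 * t * S + t\<^sup>2 * (K * S)"
    using ww by (intro add_left_mono mult_left_mono) auto
  also have "\<dots> = (nrm X v)\<^sup>2 - S / K"
    using pos by (simp add: t_def K_def[symmetric] power2_eq_square)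
  finally have "S / K \<le> (nrm X v)\<^sup>2" by simp
  moreover have "K > 0" using pos by (simp add: K_def)
  ultimately have "S \<le> K * (nrm X v)\<^sup>2" by (simp add: field_simps)
  then show ?thesis by (simp add: S_def K_def c_def)
qed

end

subsection \<open>Rank of operators and orthogonal projections\<close>

context cnormed_space
begin

lemma lincomb_add:
  assumes "finite J" "\<And>j. j \<in> J \<Longrightarrow> f j \<in> carrier X"
  shows "lincomb X J (\<lambda>j. c j + d j) f = lincomb X J c f \<oplus> lincomb X J d f"
proof -
  have "lincomb X J (\<lambda>j. c j + d j) f = (\<Oplus>j\<in>J. c j \<odot> f j \<oplus> d j \<odot> f j)"
    unfolding lincomb_def using assms(2) by (intro finsum_cong') (auto simp: smult_add_left)
  also have "\<dots> = lincomb X J c f \<oplus> lincomb X J d f"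
    unfolding lincomb_def using assms(2) by (intro finsum_addf) auto
  finally show ?thesis .
qed

lemma lincomb_smult:
  assumes "finite J" "\<And>j. j \<in> J \<Longrightarrow> f j \<in> carrier X"
  shows "lincomb X J (\<lambda>j. a * c j) f = a \<odot> lincomb X J c f"
  unfolding lincomb_def using assms
  by (subst finsum_smult_ldistr) (auto simp: smult_smult intro!: finsum_cong')

lemma lincomb_remove:
  assumes "finite J" "j \<in> J" "\<And>i. i \<in> J \<Longrightarrow> f i \<in> carrier X"
  shows "lincomb X J c f = c j \<odot> f j \<oplus> lincomb X (J - {j}) c f"
  using lincomb_insert[of "J - {j}" j f c] assms by (simp add: insert_absorb)

text \<open>Rank is defined through sets of vectors, while the spanning vectors arise as an indexed
  family. Coefficients belonging to the same vector have to be added up.\<close>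

lemma lincomb_image:
  assumes "finite J" "\<And>j. j \<in> J \<Longrightarrow> f j \<in> carrier X"
  shows "\<exists>d. lincomb X J c f = lincomb X (f ` J) d (\<lambda>b. b)"
  using assms
proof (induction J rule: finite_induct)
  case (insert j J)
  then obtain d where d: "lincomb X J c f = lincomb X (f ` J) d (\<lambda>b. b)" by auto
  have J: "b \<in> carrier X" if "b \<in> f ` J" for b using that insert by auto
  have j: "f j \<in> carrier X" using insert by auto
  have step: "lincomb X (insert j J) c f = c j \<odot> f j \<oplus> lincomb X (f ` J) d (\<lambda>b. b)"
    using insert by (simp add: lincomb_insert d)
  show ?case
  proof (cases "f j \<in> f ` J")
    case True
    let ?D = "f ` J - {f j}"
    \<comment> \<open>The vector f j has already occurred, so its new coefficient is added to the
      old one.\<close>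
    let ?e = "d(f j := c j + d (f j))"
    have D: "lincomb X ?D d (\<lambda>b. b) \<in> carrier X" using J by (intro lincomb_closed) auto
    have "lincomb X (f ` J) d (\<lambda>b. b) = d (f j) \<odot> f j \<oplus> lincomb X ?D d (\<lambda>b. b)"
      using True J insert.hyps lincomb_remove[of "f ` J" "f j" "\<lambda>b. b" d] by simp
    moreover have "lincomb X (f ` J) ?e (\<lambda>b. b) = ?e (f j) \<odot> f j \<oplus> lincomb X ?D ?e (\<lambda>b. b)"
      using True J insert.hyps lincomb_remove[of "f ` J" "f j" "\<lambda>b. b" ?e] by simp
    moreover have "lincomb X ?D ?e (\<lambda>b. b) = lincomb X ?D d (\<lambda>b. b)"
      using J by (intro lincomb_cong) auto
    ultimately have "lincomb X (insert j J) c f = lincomb X (f ` J) ?e (\<lambda>b. b)"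
      using j D by (simp add: step smult_add_left a_assoc)
    then show ?thesis using True by (metis image_insert insert_absorb)
  next
    case False
    let ?e = "d(f j := c j)"
    have ne: "b \<noteq> f j" if "b \<in> f ` J" for b using that False by blast
    have "lincomb X (insert (f j) (f ` J)) ?e (\<lambda>b. b) = ?e (f j) \<odot> f j \<oplus> lincomb X (f ` J) ?e (\<lambda>b. b)"
      using False J j insert.hyps lincomb_insert[of "f ` J" "f j" "\<lambda>b. b" ?e] by simp
    moreover have "lincomb X (f ` J) ?e (\<lambda>b. b) = lincomb X (f ` J) d (\<lambda>b. b)"
      using J ne by (intro lincomb_cong) simp_all
    ultimately show ?thesis by (intro exI[of _ ?e]) (simp add: step fun_upd_same del: fun_upd_apply)
  qed
qed auto

text \<open>A finite spanning set of least cardinality is independent: a vector with a nonzero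
  coefficient in a relation could be dropped without losing any of the span.\<close>

lemma finite_basis_from_spanning:
  assumes "finite A" "A \<subseteq> carrier X" "V = range (lin_comb X A)"
  shows "\<exists>B. finite_basis X V B \<and> card B \<le> card A"
proof -
  define P where "P B \<longleftrightarrow> finite B \<and> B \<subseteq> carrier X \<and> V = range (lin_comb X B)" for B
  have "P A" using assms by (simp add: P_def)
  then obtain B where B: "P B" and min: "\<And>C. P C \<Longrightarrow> card B \<le> card C"
    using ex_has_least_nat[of P A card] by blast
  have fin: "finite B" and car: "\<And>b. b \<in> B \<Longrightarrow> b \<in> carrier X" and V: "V = range (lin_comb X B)"
    using B by (auto simp: P_def)
  have "c b = 0" if c: "lin_comb X B c = \<zero>" and b: "b \<in> B" for c b
  proof (rule ccontr)
    assume cb: "c b \<noteq> 0"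
    let ?C = "B - {b}"
    have "\<exists>e. lin_comb X B d = lin_comb X ?C e" for d
    proof -
      \<comment> \<open>Adding this multiple of the relation c leaves the vector unchanged and makes
        the coefficient of b zero.\<close>
      let ?e = "\<lambda>i. d i + (- d b / c b) * c i"
      have dB: "lin_comb X B d \<in> carrier X"
        unfolding lin_comb_eq_lincomb using car by (intro lincomb_closed) auto
      have eC: "lin_comb X ?C ?e \<in> carrier X"
        unfolding lin_comb_eq_lincomb using car by (intro lincomb_closed) auto
      have "lin_comb X B ?e = lin_comb X B d \<oplus> (- d b / c b) \<odot> lin_comb X B c"
        unfolding lin_comb_eq_lincomb
        using lincomb_add[OF fin, of "\<lambda>b. b" d "\<lambda>i. (- d b / c b) * c i"]
          lincomb_smult[OF fin, of "\<lambda>b. b" "- d b / c b" c] car by simp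
      also have "\<dots> = lin_comb X B d"
        using dB c smult_r_null[of "- d b / c b"] by simp
      finally have "lin_comb X B d = ?e b \<odot> b \<oplus> lin_comb X ?C ?e"
        unfolding lin_comb_eq_lincomb using lincomb_remove[OF fin b, of "\<lambda>b. b" ?e] car by simp
      moreover have "?e b = 0" using cb by simp
      ultimately have "lin_comb X B d = lin_comb X ?C ?e" using car[OF b] eC by simp
      then show ?thesis by blast
    qed
    moreover have "lin_comb X ?C e = lin_comb X B (e(b := 0))" for e
    proof -
      let ?e = "e(b := 0)"
      have eC: "lin_comb X ?C e \<in> carrier X"
        unfolding lin_comb_eq_lincomb using car by (intro lincomb_closed) auto
      have "lin_comb X B ?e = ?e b \<odot> b \<oplus> lin_comb X ?C ?e"
        unfolding lin_comb_eq_lincomb using lincomb_remove[OF fin b, of "\<lambda>b. b" ?e] car by simp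
      moreover have "lin_comb X ?C ?e = lin_comb X ?C e"
        unfolding lin_comb_eq_lincomb using car by (intro lincomb_cong) auto
      ultimately show ?thesis using car[OF b] eC by simp
    qed
    ultimately have "V = range (lin_comb X ?C)"
      unfolding V by (fastforce simp: image_def)
    then have "P ?C" using B by (auto simp: P_def)
    then have "card B \<le> card ?C" by (rule min)
    then show False using b fin card_Diff1_less by fastforce
  qed
  then have "finite_basis X V B"
    using B by (auto simp: finite_basis_def P_def)
  then show ?thesis using min[OF \<open>P A\<close>] by blast
qed

end

text \<open>Because \<open>A\<close> lies inside the range, lifting its elements to preimages shows
  that every combination of \<open>A\<close> is a value of S. So the span of \<open>A\<close> is
  exactly the range, and a basis with at most \<open>card A\<close> elements can be
  extracted.\<close>

lemma (in cnormed_pair) rank_lessI: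
  assumes S: "S \<in> bounded_ops X Y" and A: "finite A" "A \<subseteq> S ` carrier X" "card A < k"
    and span: "\<And>u. u \<in> carrier X \<Longrightarrow> \<exists>c. S u = lin_comb Y A c"
  shows "rank_less X Y S k"
proof -
  obtain g where g: "\<And>a. a \<in> A \<Longrightarrow> g a \<in> carrier X \<and> S (g a) = a"
    using A(2) by (metis (no_types, lifting) image_iff subsetD)
  have car: "A \<subseteq> carrier Y" using A(2) Y.bounded_opsD(1)[OF S] by auto
  have "lin_comb Y A c = S (lincomb X A c g)" for c
  proof -
    have "S (lincomb X A c g) = lincomb Y A c (\<lambda>a. S (g a))"
      using g A by (intro op_lincomb[OF S]) auto
    also have "\<dots> = lin_comb Y A c"
      unfolding lin_comb_def lincomb_def using g car by (intro Y.finsum_cong') auto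
    finally show ?thesis by simp
  qed
  moreover have "lincomb X A c g \<in> carrier X" for c
    using g by (intro X.lincomb_closed) auto
  ultimately have "S ` carrier X = range (lin_comb Y A)"
    using span by fastforce
  then show ?thesis
    using Y.finite_basis_from_spanning[OF A(1) car] A(3) le_less_trans unfolding rank_less_def
    by metis
qed

section \<open>Orthogonal projections onto spans of orthonormal vectors\<close>

context chilbert_space
begin

definition proj :: "nat \<Rightarrow> (nat \<Rightarrow> 'u) \<Rightarrow> 'u \<Rightarrow> 'u" where
  "proj m x = (\<lambda>v\<in>carrier X. lincomb X {..<m} (\<lambda>i. ip v (x i)) x)"

definition coproj :: "nat \<Rightarrow> (nat \<Rightarrow> 'u) \<Rightarrow> 'u \<Rightarrow> 'u" where
  "coproj m x = (\<lambda>v\<in>carrier X. v \<ominus> proj m x v)"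

lemma orthonormalD:
  assumes "orthonormal m x"
  shows "i < m \<Longrightarrow> x i \<in> carrier X" and "i < m \<Longrightarrow> ip (x i) (x i) = 1"
    and "i < m \<Longrightarrow> j < m \<Longrightarrow> i \<noteq> j \<Longrightarrow> ip (x i) (x j) = 0"
  using assms by (auto simp: orthonormal_def)

lemma proj_closed: "orthonormal m x \<Longrightarrow> v \<in> carrier X \<Longrightarrow> proj m x v \<in> carrier X"
  by (auto simp: proj_def orthonormal_def intro!: lincomb_closed)

lemma ip_proj:
  assumes x: "orthonormal m x" and v: "v \<in> carrier X" and i: "i < m"
  shows "ip (proj m x v) (x i) = ip v (x i)"
proof -
  have "ip (proj m x v) (x i) = (\<Sum>j<m. ip v (x j) * ip (x j) (x i))"
    using v i orthonormalD[OF x] unfolding proj_def by (auto intro!: ip_lincomb_left)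
  also have "\<dots> = (\<Sum>j<m. if j = i then ip v (x j) else 0)"
    using i by (intro sum.cong) (auto simp: orthonormalD[OF x])
  finally show ?thesis using i by simp
qed

text \<open>By Pythagoras the two squared norms add up to ||v||^2, and each is nonnegative.\<close>

lemma nrm_proj_le:
  assumes x: "orthonormal m x" and v: "v \<in> carrier X"
  shows "nrm X (proj m x v) \<le> nrm X v" and "nrm X (coproj m x v) \<le> nrm X v"
proof -
  have "(nrm X (proj m x v))\<^sup>2 = (\<Sum>i<m. (cmod (ip v (x i)))\<^sup>2)"
    using v nrm_lincomb_orthonormal[OF x] by (simp add: proj_def)
  moreover have "(nrm X (coproj m x v))\<^sup>2 = (nrm X v)\<^sup>2 - (\<Sum>i<m. (cmod (ip v (x i)))\<^sup>2)"
    using v nrm_minus_proj[OF x] by (simp add: proj_def coproj_def)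
  moreover have "0 \<le> (nrm X (coproj m x v))\<^sup>2" "0 \<le> (\<Sum>i<m. (cmod (ip v (x i)))\<^sup>2)"
    by (auto intro: sum_nonneg)
  ultimately have "(nrm X (proj m x v))\<^sup>2 \<le> (nrm X v)\<^sup>2"
      "(nrm X (coproj m x v))\<^sup>2 \<le> (nrm X v)\<^sup>2" by auto
  then show "nrm X (proj m x v) \<le> nrm X v" "nrm X (coproj m x v) \<le> nrm X v"
    using nrm_nonneg[OF v] power2_le_imp_le by blast+
qed

lemma proj_bounded:
  assumes x: "orthonormal m x"
  shows "proj m x \<in> bounded_ops X X"
proof (rule bounded_opsI[where K = 1])
  have car: "\<And>j. j \<in> {..<m} \<Longrightarrow> x j \<in> carrier X" using x by (simp add: orthonormal_def)
  fix u v assume u: "u \<in> carrier X" and v: "v \<in> carrier X"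
  have "proj m x (u \<oplus> v) = lincomb X {..<m} (\<lambda>i. ip u (x i) + ip v (x i)) x"
    unfolding proj_def using u v car by (auto simp: ip_add_left intro!: lincomb_cong)
  then show "proj m x (u \<oplus> v) = proj m x u \<oplus> proj m x v"
    using u v lincomb_add[OF finite_lessThan car] by (simp add: proj_def)
next
  have car: "\<And>j. j \<in> {..<m} \<Longrightarrow> x j \<in> carrier X" using x by (simp add: orthonormal_def)
  fix c u assume u: "u \<in> carrier X"
  have "proj m x (c \<odot> u) = lincomb X {..<m} (\<lambda>i. c * ip u (x i)) x"
    unfolding proj_def using u car by (auto simp: ip_smult_left intro!: lincomb_cong)
  then show "proj m x (c \<odot> u) = c \<odot> proj m x u"
    using u lincomb_smult[OF finite_lessThan car] by (simp add: proj_def)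
next
  show "proj m x \<in> extensional (carrier X)" by (simp add: proj_def)
qed (use nrm_proj_le[OF x] proj_closed[OF x] in auto)

lemma coproj_closed: "orthonormal m x \<Longrightarrow> v \<in> carrier X \<Longrightarrow> coproj m x v \<in> carrier X"
  by (simp add: coproj_def proj_closed)

lemma coproj_bounded:
  assumes x: "orthonormal m x"
  shows "coproj m x \<in> bounded_ops X X"
proof (rule bounded_opsI[where K = 1])
  fix u v assume u: "u \<in> carrier X" and v: "v \<in> carrier X"
  show "coproj m x (u \<oplus> v) = coproj m x u \<oplus> coproj m x v"
    using u v proj_closed[OF x] bounded_opsD(2)[OF proj_bounded[OF x]]
    by (intro ip_eqI) (simp_all add: coproj_def ip_add_left ip_minus_left)
next
  fix c u assume u: "u \<in> carrier X"
  show "coproj m x (c \<odot> u) = c \<odot> coproj m x u"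
    using u proj_closed[OF x] bounded_opsD(3)[OF proj_bounded[OF x]]
    by (intro ip_eqI) (simp_all add: coproj_def ip_smult_left ip_minus_left algebra_simps)
next
  show "coproj m x \<in> extensional (carrier X)" by (simp add: coproj_def)
qed (use nrm_proj_le[OF x] coproj_closed[OF x] in auto)

lemma ip_coproj:
  "orthonormal m x \<Longrightarrow> v \<in> carrier X \<Longrightarrow> i < m \<Longrightarrow> ip (coproj m x v) (x i) = 0"
  by (simp add: coproj_def ip_minus_left proj_closed ip_proj orthonormalD)

lemma coproj_eq_self:
  assumes x: "orthonormal m x" and v: "v \<in> carrier X" and "\<And>i. i < m \<Longrightarrow> ip v (x i) = 0"
  shows "coproj m x v = v"
proof (rule ip_eqI)
  fix z assume z: "z \<in> carrier X"
  have "ip (proj m x v) z = (\<Sum>j<m. ip v (x j) * ip (x j) z)"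
    using v z orthonormalD[OF x] unfolding proj_def by (auto intro!: ip_lincomb_left)
  then show "ip (coproj m x v) z = ip v z"
    using assms z by (simp add: coproj_def ip_minus_left proj_closed)
qed (use assms in \<open>auto simp: coproj_closed\<close>)

lemma proj_basis:
  assumes x: "orthonormal m x" and i: "i < m"
  shows "proj m x (x i) = x i"
proof (rule ip_eqI)
  fix z assume z: "z \<in> carrier X"
  have "ip (proj m x (x i)) z = (\<Sum>j<m. ip (x i) (x j) * ip (x j) z)"
    using i z orthonormalD[OF x] unfolding proj_def by (auto intro!: ip_lincomb_left)
  also have "\<dots> = (\<Sum>j<m. if j = i then ip (x j) z else 0)"
    using i by (intro sum.cong) (auto simp: orthonormalD[OF x])
  finally show "ip (proj m x (x i)) z = ip (x i) z" using i by simp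
qed (use assms in \<open>auto simp: proj_closed orthonormalD\<close>)

end

subsection \<open>s-numbers of operators between Hilbert spaces\<close>

locale s_numbers_hilbert =
  H1: chilbert_space H1 ip1 + H2: chilbert_space H2 ip2 + s_number_function s
  for H1 H2 :: "'u cnormed" and ip1 ip2
    and s :: "'u cnormed \<Rightarrow> 'u cnormed \<Rightarrow> ('u \<Rightarrow> 'u) \<Rightarrow> nat \<Rightarrow> real"
begin

sublocale cnormed_pair H1 H2
  by (intro cnormed_pair.intro H1.cnormed_space_axioms H2.cnormed_space_axioms)

lemma s_le_op_norm_complement:
  assumes T: "T \<in> bounded_ops H1 H2" and x: "H1.orthonormal m x" and m: "m < k"
  shows "s H1 H2 T k \<le> op_norm H1 H2 (compose (carrier H1) T (H1.coproj m x))"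
proof -
  let ?S = "compose (carrier H1) T (H1.proj m x)"
  let ?R = "compose (carrier H1) T (H1.coproj m x)"
  have S: "?S \<in> bounded_ops H1 H2" and R: "?R \<in> bounded_ops H1 H2"
    by (intro bounded_ops_compose[OF H1.cnormed_space_axioms H1.cnormed_space_axioms
          H2.cnormed_space_axioms] H1.proj_bounded H1.coproj_bounded x T)+
  have TD: "T v \<in> carrier H2" if "v \<in> carrier H1" for v
    using H2.bounded_opsD(1)[OF T that] .
  have "op_add H1 H2 ?S ?R = T"
  proof (rule extensionalityI[where A = "carrier H1"])
    fix v assume v: "v \<in> carrier H1"
    have p: "H1.proj m x v \<in> carrier H1" "H1.coproj m x v \<in> carrier H1"
      using x v by (auto simp: H1.proj_closed H1.coproj_closed)
    have "H1.proj m x v \<oplus>\<^bsub>H1\<^esub> H1.coproj m x v = v"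
      using p v by (intro H1.ip_eqI) (auto simp: H1.coproj_def H1.ip_add_left H1.ip_minus_left)
    then show "op_add H1 H2 ?S ?R v = T v"
      using v p H2.bounded_opsD(2)[OF T p] by (simp add: op_add_def compose_eq)
  qed (use H2.bounded_opsD(4)[OF T] in \<open>auto simp: op_add_def\<close>)
  moreover have "rank_less H1 H2 ?S k"
  proof (rule rank_lessI[OF S])
    \<comment> \<open>These at most m vectors span the range of Tp, where p is the projection, and
      they belong to it because p fixes each x_i.\<close>
    let ?A = "(\<lambda>i. T (x i)) ` {..<m}"
    show "finite ?A" by simp
    show "card ?A < k" using card_image_le[of "{..<m}" "\<lambda>i. T (x i)"] m by simp
    show "?A \<subseteq> ?S ` carrier H1"
    proof
      fix a assume "a \<in> ?A"
      then obtain i where "i < m" "a = T (x i)" by auto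
      then show "a \<in> ?S ` carrier H1"
        using x by (intro image_eqI[of _ _ "x i"])
          (auto simp: compose_eq H1.proj_basis H1.orthonormalD)
    qed
    fix u assume u: "u \<in> carrier H1"
    have "?S u = T (lincomb H1 {..<m} (\<lambda>i. ip1 u (x i)) x)"
      using u by (simp add: compose_eq H1.proj_def)
    also have "\<dots> = lincomb H2 {..<m} (\<lambda>i. ip1 u (x i)) (\<lambda>i. T (x i))"
      using x by (intro op_lincomb[OF T]) (auto simp: H1.orthonormalD)
    finally show "\<exists>c. ?S u = lin_comb H2 ?A c"
      using H2.lincomb_image[of "{..<m}" "\<lambda>i. T (x i)" "\<lambda>i. ip1 u (x i)"] x TD
      by (simp add: lin_comb_eq_lincomb H1.orthonormalD)
  qed
  ultimately show ?thesis
    using s_add[OF H1.cbanach_space_axioms H2.cbanach_space_axioms S R, of k] m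
      s_rank[OF H1.cbanach_space_axioms H2.cbanach_space_axioms S, of k] by simp
qed

text \<open>A variational argument: if <Tx,Tz> were large, moving x a little in the direction z
  would increase ||Tx|| to first order, while ||x|| grows only to second order. This would exceed
  the bound N along the line x + t z.\<close>

lemma near_maximizer_almost_orthogonal:
  assumes T: "T \<in> bounded_ops H1 H2" and x: "x \<in> carrier H1" "ip1 x x = 1"
    and z: "z \<in> carrier H1" "ip1 x z = 0" and N: "0 < N"
    and le: "\<And>t. nrm H2 (T (x \<oplus>\<^bsub>H1\<^esub> t \<odot>\<^bsub>H1\<^esub> z)) \<le> N * nrm H1 (x \<oplus>\<^bsub>H1\<^esub> t \<odot>\<^bsub>H1\<^esub> z)"
    and \<beta>: "N\<^sup>2 - (nrm H2 (T x))\<^sup>2 \<le> \<beta>"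
  shows "(cmod (ip2 (T x) (T z)))\<^sup>2 \<le> \<beta> * N\<^sup>2 * (nrm H1 z)\<^sup>2"
proof (cases "nrm H1 z = 0")
  case True
  then have "T z = \<zero>\<^bsub>H2\<^esub>" using z H1.nrm_eq_0_imp op_zero[OF T] by auto
  then show ?thesis using H2.bounded_opsD(1)[OF T x(1)] True by simp
next
  case False
  define w where "w = ip2 (T x) (T z)"
  define W where "W = (cmod w)\<^sup>2"
  define K where "K = N\<^sup>2 * (nrm H1 z)\<^sup>2"
  \<comment> \<open>The phase of w makes both cross terms equal to W/K, a gain of 2W/K. With this K
    the allowance on the other side grows by exactly W/K, so a net W/K remains to be absorbed by the
    defect \<open>\<beta>\<close>.\<close>
  define t where "t = complex_of_real (1 / K) * w"
  have K: "K > 0" using False N by (simp add: K_def)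
  have TD: "T x \<in> carrier H2" "T z \<in> carrier H2" using H2.bounded_opsD(1)[OF T] x z by auto
  have zx: "ip1 z x = 0" using H1.ip_commute[OF x(1) z(1)] z by simp
  have cww: "w * cnj w = complex_of_real W"
    by (simp only: W_def complex_norm_square)
  have ct: "t * cnj w = complex_of_real (W / K)" "cnj t * w = complex_of_real (W / K)"
    using cww by (simp_all add: t_def mult.commute)
  have "t * cnj t = complex_of_real (1 / K) * (t * cnj w)"
    by (simp add: t_def)
  then have ctt: "t * cnj t = complex_of_real (W / K\<^sup>2)"
    unfolding ct by (simp add: power2_eq_square)
  let ?v = "x \<oplus>\<^bsub>H1\<^esub> t \<odot>\<^bsub>H1\<^esub> z"
  have v: "?v \<in> carrier H1" using x z by simp
  have Tv: "T ?v = T x \<oplus>\<^bsub>H2\<^esub> t \<odot>\<^bsub>H2\<^esub> T z"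
    using x z H2.bounded_opsD(2,3)[OF T] by simp
  have wc: "ip2 (T z) (T x) = cnj w" unfolding w_def by (rule H2.ip_commute[OF TD])
  have "ip1 ?v ?v = ip1 x x + (t * cnj t) * ip1 z z"
    using x z zx
    by (simp add: H1.ip_add_left H1.ip_add_right H1.ip_smult_left H1.ip_smult_right)
  then have "complex_of_real ((nrm H1 ?v)\<^sup>2) = complex_of_real (1 + W / K\<^sup>2 * (nrm H1 z)\<^sup>2)"
    unfolding ctt H1.ip_self[OF v] H1.ip_self[OF z(1)] x(2) by simp
  then have dom: "(nrm H1 ?v)\<^sup>2 = 1 + W / K\<^sup>2 * (nrm H1 z)\<^sup>2"
    by (simp only: of_real_eq_iff)
  have "ip2 (T ?v) (T ?v) = ip2 (T x) (T x) + cnj t * w + t * cnj w + (t * cnj t) * ip2 (T z) (T z)"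
    unfolding Tv using TD
    by (simp add: H2.ip_add_left H2.ip_add_right H2.ip_smult_left H2.ip_smult_right wc w_def
        distrib_left add.assoc mult.assoc)
  then have "complex_of_real ((nrm H2 (T ?v))\<^sup>2)
      = complex_of_real ((nrm H2 (T x))\<^sup>2 + 2 * (W / K) + W / K\<^sup>2 * (nrm H2 (T z))\<^sup>2)"
    unfolding ctt ct H2.ip_self[OF H2.bounded_opsD(1)[OF T v]] H2.ip_self[OF TD(1)] H2.ip_self[OF TD(2)]
    by simp
  then have cod: "(nrm H2 (T ?v))\<^sup>2 = (nrm H2 (T x))\<^sup>2 + 2 * (W / K) + W / K\<^sup>2 * (nrm H2 (T z))\<^sup>2"
    by (simp only: of_real_eq_iff)
  \<comment> \<open>The nonnegative second-order term in Tz is discarded.\<close>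
  have "(nrm H2 (T x))\<^sup>2 + 2 * (W / K) \<le> (nrm H2 (T ?v))\<^sup>2"
    unfolding cod by (simp add: W_def)
  also have "\<dots> \<le> (N * nrm H1 ?v)\<^sup>2"
    using le[of t] H2.bounded_opsD(1)[OF T v] by (intro power_mono H2.nrm_nonneg)
  also have "\<dots> = N\<^sup>2 * (1 + W / K\<^sup>2 * (nrm H1 z)\<^sup>2)"
    by (simp add: power_mult_distrib dom)
  also have "\<dots> = N\<^sup>2 + W / K"
  proof -
    have "N\<^sup>2 * (1 + W / K\<^sup>2 * (nrm H1 z)\<^sup>2) = N\<^sup>2 + W / K\<^sup>2 * K"
      by (simp add: K_def algebra_simps)
    then show ?thesis using K by (simp add: power2_eq_square)
  qed
  finally have "W / K \<le> \<beta>" using \<beta> by simp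
  then have "W \<le> \<beta> * K" using K by (simp add: pos_divide_le_eq)
  then show ?thesis by (simp add: W_def w_def K_def mult.assoc)
qed

text \<open>Near-orthogonality is required against every z orthogonal to x_0, ..., x_j, not just
  against the vectors chosen later. Thus it is settled at the moment x_j is chosen and the induction
  never returns to it.\<close>

lemma greedy_orthonormal:
  assumes T: "T \<in> bounded_ops H1 H2" and \<eta>: "0 < \<eta>" "\<eta> < s H1 H2 T k" and "m \<le> k"
  shows "\<exists>x. H1.orthonormal m x \<and> (\<forall>i<m. s H1 H2 T k - \<eta> \<le> nrm H2 (T (x i))) \<and>
    (\<forall>j<m. \<forall>z\<in>carrier H1. (\<forall>i\<le>j. ip1 z (x i) = 0) \<longrightarrow>
      cmod (ip2 (T (x j)) (T z)) \<le> \<eta> * nrm H1 z)"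
  using \<open>m \<le> k\<close>
proof (induction m)
  case 0
  then show ?case by (simp add: H1.orthonormal_def)
next
  case (Suc m)
  define \<sigma> where "\<sigma> = s H1 H2 T k"
  obtain x where x: "H1.orthonormal m x"
    and large: "\<And>i. i < m \<Longrightarrow> \<sigma> - \<eta> \<le> nrm H2 (T (x i))"
    and orth: "\<And>j z. j < m \<Longrightarrow> z \<in> carrier H1 \<Longrightarrow> (\<And>i. i \<le> j \<Longrightarrow> ip1 z (x i) = 0) \<Longrightarrow>
        cmod (ip2 (T (x j)) (T z)) \<le> \<eta> * nrm H1 z"
    using Suc by (auto simp: \<sigma>_def)
  let ?R = "compose (carrier H1) T (H1.coproj m x)"
  define N where "N = op_norm H1 H2 ?R"
  have R: "?R \<in> bounded_ops H1 H2"
    by (intro bounded_ops_compose[OF H1.cnormed_space_axioms H1.cnormed_space_axioms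
          H2.cnormed_space_axioms] H1.coproj_bounded x T)
  have \<sigma>N: "\<sigma> \<le> N"
    unfolding \<sigma>_def N_def using Suc.prems by (intro s_le_op_norm_complement T x) simp
  have le: "nrm H2 (T z) \<le> N * nrm H1 z"
    if "z \<in> carrier H1" "\<And>i. i < m \<Longrightarrow> ip1 z (x i) = 0" for z
    using op_norm_bound[OF R that(1)] that H1.coproj_eq_self[OF x that(1)]
    by (simp add: N_def compose_eq)
  have N: "0 < N" using \<sigma>N \<eta> by (simp add: \<sigma>_def)
  \<comment> \<open>The defect of the new vector from the supremum N. The first bound keeps the norm
    of its image above \<open>\<sigma> - \<eta>\<close>; the second makes 2 N^3
    \<open>\<delta>\<close> at most \<open>\<eta>\<close> squared, as the variational estimate with
    \<open>\<beta>\<close> = 2 N \<open>\<delta>\<close> demands.\<close>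
  define \<delta> where "\<delta> = min \<eta> (\<eta>\<^sup>2 / (2 * N ^ 3))"
  have \<delta>: "0 < \<delta>" "\<delta> \<le> \<eta>" "2 * N ^ 3 * \<delta> \<le> \<eta>\<^sup>2"
    using \<eta> N by (auto simp: \<delta>_def min_def field_simps)
  \<comment> \<open>N - \<open>\<delta>\<close> is below the operator norm. It is nonnegative, as
    \<open>op_norm_le\<close> demands, because
    \<open>\<delta> \<le> \<eta> < \<sigma> \<le> N\<close>.\<close>
  have "\<not> (\<forall>u\<in>carrier H1. nrm H2 (?R u) \<le> (N - \<delta>) * nrm H1 u)"
  proof
    assume "\<forall>u\<in>carrier H1. nrm H2 (?R u) \<le> (N - \<delta>) * nrm H1 u"
    then have "N \<le> N - \<delta>"
      unfolding N_def[symmetric] using \<delta> \<eta> \<sigma>N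
      by (subst (1) N_def, intro op_norm_le) (auto simp: \<sigma>_def)
    then show False using \<delta> by simp
  qed
  then obtain u where u: "u \<in> carrier H1" "(N - \<delta>) * nrm H1 u < nrm H2 (?R u)"
    by (auto simp: not_le)
  \<comment> \<open>Passing from u to its component orthogonal to the x_i does not increase the norm
    and leaves the image under \<open>?R\<close> equal to Tz, so z is a near-maximizer too.\<close>
  define z where "z = H1.coproj m x u"
  have z: "z \<in> carrier H1" "\<And>i. i < m \<Longrightarrow> ip1 z (x i) = 0"
    using u x by (auto simp: z_def H1.coproj_closed H1.ip_coproj)
  have "(N - \<delta>) * nrm H1 z \<le> (N - \<delta>) * nrm H1 u"
    using \<delta> \<eta> \<sigma>N u H1.nrm_proj_le(2)[OF x u(1)]
    by (intro mult_left_mono) (auto simp: z_def \<sigma>_def)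
  then have Tz: "(N - \<delta>) * nrm H1 z < nrm H2 (T z)"
    using u by (simp add: compose_eq z_def)
  have "nrm H1 z \<noteq> 0"
  proof
    assume "nrm H1 z = 0"
    then show False using Tz le[OF z] by simp
  qed
  then have nz: "0 < nrm H1 z" using H1.nrm_nonneg[OF z(1)] by simp
  define r where "r = inverse (nrm H1 z)"
  have r: "0 < r" "r * nrm H1 z = 1" using nz by (auto simp: r_def)
  define e where "e = complex_of_real r \<odot>\<^bsub>H1\<^esub> z"
  have e: "e \<in> carrier H1" using z by (simp add: e_def)
  have e_orth: "ip1 e (x i) = 0" "ip1 (x i) e = 0" if "i < m" for i
  proof -
    have xi: "x i \<in> carrier H1" using that x by (simp add: H1.orthonormalD)
    show "ip1 e (x i) = 0"
      using that z xi by (simp add: e_def H1.ip_smult_left)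
    then show "ip1 (x i) e = 0" using H1.ip_commute[OF e xi] by simp
  qed
  have "nrm H1 e = 1" using z r by (simp add: e_def H1.nrm_smult)
  then have ee: "ip1 e e = 1" using H1.ip_self[OF e] by simp
  have "nrm H2 (T e) = r * nrm H2 (T z)"
    using z r H2.bounded_opsD[OF T] by (simp add: e_def H2.nrm_smult)
  moreover have "r * ((N - \<delta>) * nrm H1 z) < r * nrm H2 (T z)"
    using Tz r by simp
  moreover have "r * ((N - \<delta>) * nrm H1 z) = N - \<delta>"
    using r by (metis mult.left_commute mult.right_neutral)
  ultimately have Te: "N - \<delta> \<le> nrm H2 (T e)" by simp
  define y where "y = x(m := e)"
  have y_old: "y i = x i" if "i < m" for i using that by (simp add: y_def)
  have y_new: "y m = e" by (simp add: y_def)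
  have "H1.orthonormal (Suc m) y"
    using x e e_orth ee by (auto simp: H1.orthonormal_def less_Suc_eq y_def)
  moreover have "\<sigma> - \<eta> \<le> nrm H2 (T (y i))" if "i < Suc m" for i
    using that large[of i] Te \<delta> \<sigma>N by (cases "i = m") (auto simp: y_def less_Suc_eq)
  moreover have "cmod (ip2 (T (y j)) (T w)) \<le> \<eta> * nrm H1 w"
    if j: "j < Suc m" and w: "w \<in> carrier H1" and perp: "\<And>i. i \<le> j \<Longrightarrow> ip1 w (y i) = 0" for j w
  proof (cases "j = m")
    case False
    then have "j < m" using j by simp
    then show ?thesis using orth[of j w] w perp y_old by simp
  next
    case True
    have we: "ip1 w e = 0" and wx: "\<And>i. i < m \<Longrightarrow> ip1 w (x i) = 0"
      using perp True y_new y_old by (metis le_refl, metis less_imp_le)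
    have ew: "ip1 e w = 0" using H1.ip_commute[OF w e] we by simp
    have "N\<^sup>2 - (nrm H2 (T e))\<^sup>2 \<le> 2 * N * \<delta>"
    proof -
      have "(N - \<delta>)\<^sup>2 \<le> (nrm H2 (T e))\<^sup>2"
        using Te \<delta> \<eta> \<sigma>N by (intro power_mono) (auto simp: \<sigma>_def)
      then have "N\<^sup>2 - (nrm H2 (T e))\<^sup>2 \<le> N\<^sup>2 - (N - \<delta>)\<^sup>2" by simp
      also have "\<dots> \<le> 2 * N * \<delta>" by (simp add: power2_eq_square algebra_simps)
      finally show ?thesis .
    qed
    \<comment> \<open>All vectors e + t w are orthogonal to the earlier x_i, so the bound by N holds
      on the whole line.\<close>
    then have "(cmod (ip2 (T e) (T w)))\<^sup>2 \<le> 2 * N * \<delta> * N\<^sup>2 * (nrm H1 w)\<^sup>2"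
    proof (rule near_maximizer_almost_orthogonal[OF T e ee w ew N, rotated])
      fix t
      show "nrm H2 (T (e \<oplus>\<^bsub>H1\<^esub> t \<odot>\<^bsub>H1\<^esub> w)) \<le> N * nrm H1 (e \<oplus>\<^bsub>H1\<^esub> t \<odot>\<^bsub>H1\<^esub> w)"
        using e w x e_orth wx
        by (intro le) (simp_all add: H1.ip_add_left H1.ip_smult_left H1.orthonormalD)
    qed
    also have "\<dots> = 2 * N ^ 3 * \<delta> * (nrm H1 w)\<^sup>2"
      by (simp add: power2_eq_square power3_eq_cube)
    also have "\<dots> \<le> \<eta>\<^sup>2 * (nrm H1 w)\<^sup>2"
      using \<delta> by (intro mult_right_mono) auto
    finally have "(cmod (ip2 (T e) (T w)))\<^sup>2 \<le> (\<eta> * nrm H1 w)\<^sup>2"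
      by (simp add: power_mult_distrib)
    then show ?thesis
      unfolding True y_new
      by (rule power2_le_imp_le) (use \<eta> H1.nrm_nonneg[OF w] in simp)
  qed
  ultimately show ?case unfolding \<sigma>_def by blast
qed

text \<open>The identity of k-dimensional Hilbert space nearly factors through S: V embeds the span
  of the x_i isometrically, U takes the products with the u_j and has norm at most C, and the matrix
  of USV differs from the identity by at most \<open>\<rho>\<close> in each entry. Axioms (5), (2)
  and (3) then apply in turn.\<close>

lemma s_ge_dual_system:
  assumes S: "S \<in> bounded_ops H1 H2" and k: "1 \<le> k" and x: "H1.orthonormal k x"
    and u: "\<And>j. j < k \<Longrightarrow> u j \<in> carrier H2"
    and bessel: "\<And>v. v \<in> carrier H2 \<Longrightarrow> (\<Sum>j<k. (cmod (ip2 v (u j)))\<^sup>2) \<le> (C * nrm H2 v)\<^sup>2"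
    and C: "0 \<le> C" and \<rho>: "0 \<le> \<rho>"
    and dual: "\<And>i j. i < k \<Longrightarrow> j < k \<Longrightarrow> cmod ((if i = j then 1 else 0) - ip2 (S (x i)) (u j)) \<le> \<rho>"
  shows "1 - k * \<rho> \<le> C * s H1 H2 S k"
proof -
  \<comment> \<open>The model space is laid on the span of the x_i, with the inner products as
    coordinates; the map V below is then its inclusion into H1.\<close>
  define A where "A = (\<lambda>c. lincomb H1 {..<k} c x) ` ({..<k} \<rightarrow>\<^sub>E UNIV)"
  define \<phi> where "\<phi> v = (\<lambda>i\<in>{..<k}. ip1 v (x i))" for v
  have car: "x i \<in> carrier H1" if "i \<in> {..<k}" for i using x that by (simp add: H1.orthonormalD)
  have \<phi>_comb: "\<phi> (lincomb H1 {..<k} c x) = c" if c: "c \<in> {..<k} \<rightarrow>\<^sub>E UNIV" for c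
  proof (rule extensionalityI[where A = "{..<k}"])
    fix i assume i: "i \<in> {..<k}"
    have "ip1 (lincomb H1 {..<k} c x) (x i) = (\<Sum>j<k. c j * ip1 (x j) (x i))"
      using car i by (intro H1.ip_lincomb_left) auto
    also have "\<dots> = (\<Sum>j<k. if j = i then c j else 0)"
      using i by (intro sum.cong) (auto simp: H1.orthonormalD[OF x])
    finally show "\<phi> (lincomb H1 {..<k} c x) i = c i" using i by (simp add: \<phi>_def)
  qed (use c in \<open>auto simp: \<phi>_def PiE_def\<close>)
  have "bij_betw \<phi> A ({..<k} \<rightarrow>\<^sub>E UNIV)"
    by (rule bij_betw_byWitness[where f' = "\<lambda>c. lincomb H1 {..<k} c x"])
       (auto simp: A_def \<phi>_comb)
  then interpret ell2_coordinates k A \<phi>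
    by (rule ell2_coordinates.intro)
  interpret E: cnormed_space E by (rule cnormed_space_E)
  interpret EH1: cnormed_pair E H1
    by (intro cnormed_pair.intro cnormed_space_E H1.cnormed_space_axioms)
  interpret H2E: cnormed_pair H2 E
    by (intro cnormed_pair.intro cnormed_space_E H2.cnormed_space_axioms)
  interpret EE: cnormed_pair E E
    by (intro cnormed_pair.intro cnormed_space_E)
  define V where "V = (\<lambda>e\<in>A. lincomb H1 {..<k} (\<phi>0 e) x)"
  define U where "U = (\<lambda>y\<in>carrier H2. \<psi> (\<lambda>j. ip2 y (u j)))"
  have V_in: "V e \<in> carrier H1" if "e \<in> A" for e
    using that car by (auto simp: V_def intro!: H1.lincomb_closed)
  have V_nrm: "nrm H1 (V e) = nrm E e" if "e \<in> A" for e
  proof -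
    have "(nrm H1 (V e))\<^sup>2 = (nrm E e)\<^sup>2"
      using that H1.nrm_lincomb_orthonormal[OF x] by (simp add: V_def nrm_E sum_nonneg)
    then show ?thesis
      using that H1.nrm_nonneg[OF V_in[OF that]] E.nrm_nonneg[of e] by (simp add: power2_eq_iff_nonneg)
  qed
  have V: "V \<in> bounded_ops E H1"
  proof (rule bounded_opsI[where K = 1])
    fix e f assume ef: "e \<in> carrier E" "f \<in> carrier E"
    have "V (e \<oplus>\<^bsub>E\<^esub> f) = lincomb H1 {..<k} (\<lambda>i. \<phi>0 e i + \<phi>0 f i) x"
      using car by (auto simp: V_def add_E intro!: H1.lincomb_cong)
    then show "V (e \<oplus>\<^bsub>E\<^esub> f) = V e \<oplus>\<^bsub>H1\<^esub> V f"
      using ef H1.lincomb_add[OF finite_lessThan car] by (simp add: V_def)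
  next
    fix c e assume e: "e \<in> carrier E"
    have "V (c \<odot>\<^bsub>E\<^esub> e) = lincomb H1 {..<k} (\<lambda>i. c * \<phi>0 e i) x"
      using car by (auto simp: V_def smult_E intro!: H1.lincomb_cong)
    then show "V (c \<odot>\<^bsub>E\<^esub> e) = c \<odot>\<^bsub>H1\<^esub> V e"
      using e H1.lincomb_smult[OF finite_lessThan car] by (simp add: V_def)
  qed (auto simp: V_in V_nrm, simp add: V_def)
  have U_nrm: "nrm E (U y) \<le> C * nrm H2 y" if "y \<in> carrier H2" for y
  proof -
    have "nrm E (U y) = sqrt (\<Sum>j<k. (cmod (ip2 y (u j)))\<^sup>2)"
      using that by (simp add: U_def nrm_E)
    also have "\<dots> \<le> sqrt ((C * nrm H2 y)\<^sup>2)"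
      using bessel[OF that] by (rule real_sqrt_le_mono)
    finally show ?thesis using C H2.nrm_nonneg[OF that] by simp
  qed
  have U: "U \<in> bounded_ops H2 E"
  proof (rule bounded_opsI[where K = C])
    show "U \<in> extensional (carrier H2)" by (simp add: U_def)
    show "nrm E (U y) \<le> C * nrm H2 y" if "y \<in> carrier H2" for y using U_nrm[OF that] .
  qed (auto simp: U_def add_E smult_E u H2.ip_add_left H2.ip_smult_left intro!: coord_eqI)
  define W where "W = compose (carrier E) U (compose (carrier E) S V)"
  have W: "W \<in> bounded_ops E E"
    unfolding W_def
    by (intro bounded_ops_compose[OF cnormed_space_E H2.cnormed_space_axioms cnormed_space_E]
        bounded_ops_compose[OF cnormed_space_E H1.cnormed_space_axioms H2.cnormed_space_axioms] S U V)
  have W_in: "W e \<in> A" if "e \<in> A" for e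
    using E.bounded_opsD(1)[OF W, of e] that by simp
  have W_coord: "\<phi>0 (W e) j = (\<Sum>i<k. \<phi>0 e i * ip2 (S (x i)) (u j))" if "e \<in> A" "j < k" for e j
  proof -
    have "S (V e) = lincomb H2 {..<k} (\<phi>0 e) (\<lambda>i. S (x i))"
      using that car op_lincomb[OF S, of "{..<k}" x "\<phi>0 e"] by (simp add: V_def)
    moreover have "ip2 (lincomb H2 {..<k} (\<phi>0 e) (\<lambda>i. S (x i))) (u j) = (\<Sum>i<k. \<phi>0 e i * ip2 (S (x i)) (u j))"
      using car H2.bounded_opsD(1)[OF S] u[OF that(2)] by (intro H2.ip_lincomb_left) auto
    ultimately have "ip2 (S (V e)) (u j) = (\<Sum>i<k. \<phi>0 e i * ip2 (S (x i)) (u j))" by simp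
    then show ?thesis
      using that H2.bounded_opsD(1)[OF S V_in] by (simp add: W_def compose_eq U_def)
  qed
  \<comment> \<open>R is the remainder I - USV, written in coordinates.\<close>
  define R where "R = (\<lambda>e\<in>A. \<psi> (\<lambda>j. \<phi>0 e j - \<phi>0 (W e) j))"
  have R_nrm: "nrm E (R e) \<le> (k * \<rho>) * nrm E e" if e: "e \<in> A" for e
  proof -
    \<comment> \<open>Each coordinate of R e is at most \<open>\<rho>\<close> a. Cauchy-Schwarz for
      a costs a factor sqrt k and the k coordinates cost another, which gives k
      \<open>\<rho>\<close>.\<close>
    define a where "a = (\<Sum>i<k. cmod (\<phi>0 e i))"
    have "(cmod (\<phi>0 (R e) j))\<^sup>2 \<le> \<rho>\<^sup>2 * a\<^sup>2" if j: "j < k" for j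
    proof -
      have "\<phi>0 (R e) j = (\<Sum>i<k. if i = j then \<phi>0 e i else 0) - (\<Sum>i<k. \<phi>0 e i * ip2 (S (x i)) (u j))"
        using e j by (simp add: R_def W_coord)
      also have "\<dots> = (\<Sum>i<k. \<phi>0 e i * ((if i = j then 1 else 0) - ip2 (S (x i)) (u j)))"
        unfolding sum_subtractf[symmetric] by (intro sum.cong) (auto simp: algebra_simps)
      also have "cmod \<dots> \<le> (\<Sum>i<k. cmod (\<phi>0 e i) * \<rho>)"
      proof (rule sum_norm_le)
        fix i assume "i \<in> {..<k}"
        then show "cmod (\<phi>0 e i * ((if i = j then 1 else 0) - ip2 (S (x i)) (u j))) \<le> cmod (\<phi>0 e i) * \<rho>"
          unfolding norm_mult using dual[of i j] j by (intro mult_left_mono) auto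
      qed
      also have "\<dots> = \<rho> * a" by (simp add: a_def sum_distrib_left mult.commute)
      finally have "(cmod (\<phi>0 (R e) j))\<^sup>2 \<le> (\<rho> * a)\<^sup>2" by (intro power_mono) auto
      then show ?thesis by (simp add: power_mult_distrib)
    qed
    then have "(\<Sum>j<k. (cmod (\<phi>0 (R e) j))\<^sup>2) \<le> (\<Sum>j<k. \<rho>\<^sup>2 * a\<^sup>2)"
      by (intro sum_mono) auto
    also have "\<dots> = (k * \<rho>\<^sup>2) * a\<^sup>2" by simp
    also have "\<dots> \<le> (k * \<rho>\<^sup>2) * (k * (\<Sum>i<k. (cmod (\<phi>0 e i))\<^sup>2))"
      unfolding a_def by (intro mult_left_mono sum_squared_le_card) auto
    also have "\<dots> = ((k * \<rho>) * nrm E e)\<^sup>2"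
      by (simp add: nrm_E sum_nonneg power_mult_distrib power2_eq_square[of "real k"])
    finally have "nrm E (R e) \<le> sqrt (((k * \<rho>) * nrm E e)\<^sup>2)"
      unfolding nrm_E[of "R e"] by (rule real_sqrt_le_mono)
    then show ?thesis using \<rho> e E.nrm_nonneg[of e] by simp
  qed
  have R: "R \<in> bounded_ops E E"
  proof (rule bounded_opsI[where K = "k * \<rho>"])
    fix e f assume ef: "e \<in> carrier E" "f \<in> carrier E"
    have "W (e \<oplus>\<^bsub>E\<^esub> f) = W e \<oplus>\<^bsub>E\<^esub> W f" using E.bounded_opsD(2)[OF W ef] .
    then show "R (e \<oplus>\<^bsub>E\<^esub> f) = R e \<oplus>\<^bsub>E\<^esub> R f"
      using ef by (simp add: R_def add_E) (auto intro!: coord_eqI)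
  next
    fix c e assume e: "e \<in> carrier E"
    have "W (c \<odot>\<^bsub>E\<^esub> e) = c \<odot>\<^bsub>E\<^esub> W e" using E.bounded_opsD(3)[OF W e] .
    then show "R (c \<odot>\<^bsub>E\<^esub> e) = c \<odot>\<^bsub>E\<^esub> R e"
      using e by (simp add: R_def smult_E) (auto simp: algebra_simps intro!: coord_eqI)
  qed (auto simp: R_nrm, auto simp: R_def)
  have "op_add E E W R = op_id E"
    unfolding op_add_def op_id_def
    by (intro restrict_ext coord_eqI) (auto simp: add_E R_def)
  then have "1 = s E E (op_add E E W R) k"
    using s_ell2[OF k is_ell2_E] by simp
  also have "\<dots> \<le> s E E W k + op_norm E E R"
    by (rule s_add[OF cbanach_space_E cbanach_space_E W R k])
  also have "\<dots> \<le> s E E W k + k * \<rho>"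
    using R_nrm \<rho> by (intro add_left_mono EE.op_norm_le) auto
  finally have "1 - k * \<rho> \<le> s E E W k" by simp
  also have "\<dots> \<le> op_norm H2 E U * s H1 H2 S k * op_norm E H1 V"
    unfolding W_def
    by (rule s_compose[OF cbanach_space_E H1.cbanach_space_axioms H2.cbanach_space_axioms
          cbanach_space_E V S U k])
  also have "\<dots> \<le> C * s H1 H2 S k * 1"
  proof (intro mult_mono)
    show "op_norm H2 E U \<le> C" using U_nrm C by (intro H2E.op_norm_le)
    show "op_norm E H1 V \<le> 1" using V_nrm by (intro EH1.op_norm_le) auto
    show "0 \<le> op_norm E H1 V" by (rule EH1.op_norm_nonneg[OF V])
    show "0 \<le> s H1 H2 S k"
      by (rule s_nonneg[OF H1.cbanach_space_axioms H2.cbanach_space_axioms S k])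
    then show "0 \<le> C * s H1 H2 S k" using C by simp
  qed (use C s_nonneg[OF H1.cbanach_space_axioms H2.cbanach_space_axioms S k] in auto)
  finally show ?thesis by simp
qed

text \<open>The vectors u_j = T x_j / ||T x_j||^2 are nearly dual to the T x_i, and by weak*
  convergence nearly dual to the T_n x_i for large n. Their Gram matrix has diagonal at most 1/a^2
  and other entries at most \<open>\<eta>\<close>/a^4, which yields the constant under the
  root.\<close>

lemma eventually_s_ge:
  assumes T: "T \<in> bounded_ops H1 H2" and Tn: "\<And>n. Tn n \<in> bounded_ops H1 H2"
    and weak: "weak_star_tendsto H1 H2 ip2 Tn T" and k: "1 \<le> k"
    and \<eta>: "0 < \<eta>" "\<eta> < s H1 H2 T k" and a: "a = s H1 H2 T k - \<eta>"
  shows "\<forall>\<^sub>F n in sequentially.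
    1 - k * (2 * \<eta> / a\<^sup>2) \<le> sqrt (1 / a\<^sup>2 + k * (\<eta> / a ^ 4)) * s H1 H2 (Tn n) k"
proof -
  have a0: "0 < a" using \<eta> a by simp
  obtain x where x: "H1.orthonormal k x"
    and large: "\<And>i. i < k \<Longrightarrow> a \<le> nrm H2 (T (x i))"
    and orth: "\<And>j z. j < k \<Longrightarrow> z \<in> carrier H1 \<Longrightarrow> (\<And>i. i \<le> j \<Longrightarrow> ip1 z (x i) = 0) \<Longrightarrow>
        cmod (ip2 (T (x j)) (T z)) \<le> \<eta> * nrm H1 z"
    using greedy_orthonormal[OF T \<eta> order_refl] a by blast
  have car: "x i \<in> carrier H1" if "i < k" for i using x that by (simp add: H1.orthonormalD)
  have Tcar: "T (x i) \<in> carrier H2" if "i < k" for i using H2.bounded_opsD(1)[OF T car[OF that]] .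
  have nrm1: "nrm H1 (x i) = 1" if "i < k" for i
    using H1.nrm_sq[OF car[OF that]] that x H1.nrm_nonneg[OF car[OF that]]
    by (simp add: H1.orthonormalD power2_eq_1_iff)
  have orth_less: "cmod (ip2 (T (x i)) (T (x j))) \<le> \<eta>" if "i < j" "j < k" for i j
    using orth[of i "x j"] that car nrm1 by (simp add: H1.orthonormalD[OF x])
  \<comment> \<open>The greedy choice covers i < j only; conjugate symmetry gives the rest.\<close>
  have off: "cmod (ip2 (T (x i)) (T (x j))) \<le> \<eta>" if "i < k" "j < k" "i \<noteq> j" for i j
  proof (cases "i < j")
    case False
    then show ?thesis
      using orth_less[of j i] that H2.ip_commute[OF Tcar[OF that(2)] Tcar[OF that(1)]] by simp
  qed (use orth_less that in simp)
  define q where "q j = 1 / (nrm H2 (T (x j)))\<^sup>2" for j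
  have q: "0 < q j" "q j \<le> 1 / a\<^sup>2" "q j * (nrm H2 (T (x j)))\<^sup>2 = 1" if "j < k" for j
  proof -
    have "a\<^sup>2 \<le> (nrm H2 (T (x j)))\<^sup>2" using large[OF that] a0 by (intro power_mono) auto
    moreover have "0 < nrm H2 (T (x j))" using large[OF that] a0 by simp
    ultimately show "0 < q j" "q j \<le> 1 / a\<^sup>2" "q j * (nrm H2 (T (x j)))\<^sup>2 = 1"
      using a0 by (auto simp: q_def intro!: frac_le)
  qed
  define u where "u j = complex_of_real (q j) \<odot>\<^bsub>H2\<^esub> T (x j)" for j
  have u: "u j \<in> carrier H2" if "j < k" for j using Tcar[OF that] by (simp add: u_def)
  have ip_u: "ip2 v (u j) = complex_of_real (q j) * ip2 v (T (x j))"
    if "v \<in> carrier H2" "j < k" for v j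
    using that Tcar by (simp add: u_def H2.ip_smult_right)
  have gram: "cmod (ip2 (u i) (u j)) \<le> (if i = j then 1 / a\<^sup>2 else 0) + \<eta> / a ^ 4"
    if "i < k" "j < k" for i j
  proof -
    have "ip2 (u i) (u j) = complex_of_real (q i * q j) * ip2 (T (x i)) (T (x j))"
      using that Tcar by (simp add: u_def H2.ip_smult_right H2.ip_smult_left)
    then have eq: "cmod (ip2 (u i) (u j)) = q i * q j * cmod (ip2 (T (x i)) (T (x j)))"
      using q(1)[OF that(1)] q(1)[OF that(2)] by (simp add: norm_mult)
    show ?thesis
    proof (cases "i = j")
      case True
      have "cmod (ip2 (u i) (u j)) = q i * (q i * (nrm H2 (T (x i)))\<^sup>2)"
        unfolding eq using True that H2.ip_self[OF Tcar[OF that(1)]]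
        by (simp add: norm_power H2.nrm_nonneg[OF Tcar])
      also have "\<dots> = q i" unfolding q(3)[OF that(1)] by simp
      also have "\<dots> \<le> 1 / a\<^sup>2" by (rule q(2)[OF that(1)])
      finally show ?thesis using True \<eta> a0 by (simp add: add_increasing2)
    next
      case False
      have "q i * q j * cmod (ip2 (T (x i)) (T (x j))) \<le> 1 / a\<^sup>2 * (1 / a\<^sup>2) * \<eta>"
        using q[OF that(1)] q[OF that(2)] off[OF that False] \<eta> by (intro mult_mono) auto
      also have "\<dots> = \<eta> / a ^ 4" by (simp add: power4_eq_xxxx power2_eq_square)
      finally show ?thesis using False by (simp add: eq)
    qed
  qed
  define C where "C = sqrt (1 / a\<^sup>2 + k * (\<eta> / a ^ 4))"
  have C2: "C\<^sup>2 = 1 / a\<^sup>2 + k * (\<eta> / a ^ 4)" and C0: "0 \<le> C"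
    unfolding C_def using \<eta> a0 by auto
  have bessel: "(\<Sum>j<k. (cmod (ip2 v (u j)))\<^sup>2) \<le> (C * nrm H2 v)\<^sup>2" if v: "v \<in> carrier H2" for v
  proof -
    have "(\<Sum>j<k. (cmod (ip2 v (u j)))\<^sup>2) \<le> (1 / a\<^sup>2 + k * (\<eta> / a ^ 4)) * (nrm H2 v)\<^sup>2"
      using \<eta> a0 by (intro H2.bessel_near_orthogonal u gram v) (auto intro!: add_pos_nonneg)
    then show ?thesis by (simp add: power_mult_distrib C2)
  qed
  \<comment> \<open>Only the k^2 pairs (x_i, T x_j) matter, so a common threshold for n
    exists.\<close>
  have conv: "\<forall>\<^sub>F n in sequentially.
      dist (ip2 (Tn n (x i)) (T (x j))) (ip2 (T (x i)) (T (x j))) < \<eta>" if "i < k" "j < k" for i j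
    by (rule tendstoD[OF _ \<eta>(1)])
       (rule weak[unfolded weak_star_tendsto_def, rule_format, OF car[OF that(1)] Tcar[OF that(2)]])
  have "\<forall>\<^sub>F n in sequentially. \<forall>i\<in>{..<k}. \<forall>j\<in>{..<k}.
      dist (ip2 (Tn n (x i)) (T (x j))) (ip2 (T (x i)) (T (x j))) < \<eta>"
    by (intro eventually_ball_finite finite_lessThan ballI conv) simp_all
  then show ?thesis
    unfolding C_def[symmetric]
  proof (eventually_elim)
    fix n assume close: "\<forall>i\<in>{..<k}. \<forall>j\<in>{..<k}. dist (ip2 (Tn n (x i)) (T (x j))) (ip2 (T (x i)) (T (x j))) < \<eta>"
    have "cmod ((if i = j then 1 else 0) - ip2 (Tn n (x i)) (u j)) \<le> 2 * \<eta> / a\<^sup>2"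
      if ij: "i < k" "j < k" for i j
    proof -
      define g where "g = ip2 (Tn n (x i)) (T (x j))"
      \<comment> \<open>The Gram entry of the T x_i with off-diagonal terms replaced by 0, so that
        q_j h is the Kronecker delta. Replacing it by the true entry costs \<open>\<eta>\<close>,
        and passing from T to T_n costs another \<open>\<eta>\<close>.\<close>
      define h where "h = (if i = j then complex_of_real ((nrm H2 (T (x j)))\<^sup>2) else 0)"
      have "cmod (h - g) \<le> cmod (h - ip2 (T (x i)) (T (x j))) + cmod (ip2 (T (x i)) (T (x j)) - g)"
        by (rule norm_diff_triangle_le[OF order_refl order_refl])
      also have "\<dots> \<le> \<eta> + \<eta>"
      proof (rule add_mono)
        show "cmod (h - ip2 (T (x i)) (T (x j))) \<le> \<eta>"
          using off[OF ij] \<eta> H2.ip_self[OF Tcar[OF ij(2)]] by (auto simp: h_def)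
        show "cmod (ip2 (T (x i)) (T (x j)) - g) \<le> \<eta>"
          using close ij by (simp add: g_def dist_norm norm_minus_commute less_imp_le)
      qed
      finally have hg: "cmod (h - g) \<le> 2 * \<eta>" by simp
      have "complex_of_real (q j) * h = complex_of_real (if i = j then q j * (nrm H2 (T (x j)))\<^sup>2 else 0)"
        by (simp add: h_def)
      also have "\<dots> = (if i = j then 1 else 0)"
        unfolding q(3)[OF ij(2)] by simp
      finally have "(if i = j then 1 else 0) - ip2 (Tn n (x i)) (u j) = complex_of_real (q j) * (h - g)"
        using ip_u[OF H2.bounded_opsD(1)[OF Tn car[OF ij(1)]] ij(2), of n] by (simp add: g_def algebra_simps)
      then have "cmod ((if i = j then 1 else 0) - ip2 (Tn n (x i)) (u j)) = q j * cmod (h - g)"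
        using q(1)[OF ij(2)] by (simp add: norm_mult)
      also have "\<dots> \<le> 1 / a\<^sup>2 * (2 * \<eta>)"
        using q[OF ij(2)] hg by (intro mult_mono) auto
      finally show ?thesis by simp
    qed
    then show "1 - k * (2 * \<eta> / a\<^sup>2) \<le> C * s H1 H2 (Tn n) k"
      using \<eta> by (intro s_ge_dual_system[OF Tn k x u bessel C0]) auto
  qed
qed

end

section \<open>Convergence of the s-numbers\<close>

theorem theorem6:
  fixes s :: "'u cnormed \<Rightarrow> 'u cnormed \<Rightarrow> ('u \<Rightarrow> 'u) \<Rightarrow> nat \<Rightarrow> real"
    and H1 H2 :: "'u cnormed" and ip1 ip2 :: "'u \<Rightarrow> 'u \<Rightarrow> complex"
    and T :: "'u \<Rightarrow> 'u" and P Q Tn :: "nat \<Rightarrow> 'u \<Rightarrow> 'u" and k :: nat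
  assumes "chilbert_space H1 ip1" and "chilbert_space H2 ip2"
    and "T \<in> bounded_ops H1 H2"
    and "s_number_function s"
    and "\<And>n. P n \<in> bounded_ops H1 H1"
    and "\<And>n. Q n \<in> bounded_ops H2 H2"
    and "\<And>n. op_norm H1 H1 (P n) * op_norm H2 H2 (Q n) \<le> 1"
    and "\<And>n. Tn n = compose (carrier H1) (Q n) (compose (carrier H1) T (P n))"
    and "weak_star_tendsto H1 H2 ip2 Tn T"
    and "1 \<le> k"
  shows "(\<lambda>n. s H1 H2 (Tn n) k) \<longlonglongrightarrow> s H1 H2 T k"
proof -
  interpret s_numbers_hilbert H1 H2 ip1 ip2 s
    by (intro s_numbers_hilbert.intro assms)
  have Tn: "Tn n \<in> bounded_ops H1 H2" for n
    unfolding assms(8) using assms(3,5,6)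
    by (meson bounded_ops_compose H1.cnormed_space_axioms H2.cnormed_space_axioms)
  define \<sigma> where "\<sigma> = s H1 H2 T k"
  have \<sigma>0: "0 \<le> \<sigma>"
    unfolding \<sigma>_def by (rule s_nonneg[OF H1.cbanach_space_axioms H2.cbanach_space_axioms assms(3,10)])
  have upper: "s H1 H2 (Tn n) k \<le> \<sigma>" for n
  proof -
    have "s H1 H2 (Tn n) k \<le> op_norm H2 H2 (Q n) * \<sigma> * op_norm H1 H1 (P n)"
      unfolding assms(8) \<sigma>_def
      by (rule s_compose[OF H1.cbanach_space_axioms H1.cbanach_space_axioms
            H2.cbanach_space_axioms H2.cbanach_space_axioms assms(5,3,6,10)])
    also have "\<dots> = (op_norm H1 H1 (P n) * op_norm H2 H2 (Q n)) * \<sigma>" by simp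
    also have "\<dots> \<le> 1 * \<sigma>" using assms(7) \<sigma>0 by (intro mult_right_mono)
    finally show ?thesis by simp
  qed
  have lower: "\<forall>\<^sub>F n in sequentially. c < s H1 H2 (Tn n) k" if c: "c < \<sigma>" for c
  proof (cases "\<sigma> = 0")
    case True
    have "0 \<le> s H1 H2 (Tn n) k" for n
      by (rule s_nonneg[OF H1.cbanach_space_axioms H2.cbanach_space_axioms Tn assms(10)])
    then show ?thesis using c True by (intro always_eventually allI) (metis less_le_trans)
  next
    case False
    then have pos: "0 < \<sigma>" using \<sigma>0 by simp
    \<comment> \<open>As \<open>\<eta>\<close> decreases to 0 with k fixed, the root tends to
      1/\<open>\<sigma>\<close> and the quotient \<open>?f\<close> to \<open>\<sigma>\<close>. Hence
      one \<open>\<eta>\<close>, chosen before n, already gives a lower bound above c.\<close>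
    let ?C = "\<lambda>\<eta>. sqrt (1 / (\<sigma> - \<eta>)\<^sup>2 + k * (\<eta> / (\<sigma> - \<eta>) ^ 4))"
    let ?f = "\<lambda>\<eta>. (1 - k * (2 * \<eta> / (\<sigma> - \<eta>)\<^sup>2)) / ?C \<eta>"
    have "(?f \<longlongrightarrow> (1 - k * (2 * 0 / (\<sigma> - 0)\<^sup>2)) / ?C 0) (at_right 0)"
      using pos by (intro tendsto_intros) auto
    moreover have "(1 - k * (2 * 0 / (\<sigma> - 0)\<^sup>2)) / ?C 0 = \<sigma>"
      using pos by (simp add: real_sqrt_divide)
    ultimately have "\<forall>\<^sub>F \<eta> in at_right 0. c < ?f \<eta>"
      using c by (simp only: order_tendstoD(1))
    moreover have "\<forall>\<^sub>F \<eta> in at_right 0. 0 < \<eta> \<and> \<eta> < \<sigma>"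
      using pos eventually_at_right_field by auto
    ultimately have "\<forall>\<^sub>F \<eta> in at_right 0. c < ?f \<eta> \<and> 0 < \<eta> \<and> \<eta> < \<sigma>"
      by (rule eventually_conj)
    then obtain \<eta> where \<eta>: "c < ?f \<eta>" "0 < \<eta>" "\<eta> < \<sigma>"
      using eventually_happens trivial_limit_at_right_real by blast
    have "0 < 1 / (\<sigma> - \<eta>)\<^sup>2 + k * (\<eta> / (\<sigma> - \<eta>) ^ 4)"
      using \<eta> by (intro add_pos_nonneg) auto
    then have C: "0 < ?C \<eta>" by simp
    have "\<forall>\<^sub>F n in sequentially.
        1 - k * (2 * \<eta> / (\<sigma> - \<eta>)\<^sup>2) \<le> ?C \<eta> * s H1 H2 (Tn n) k"
      using \<eta> by (intro eventually_s_ge[OF assms(3) Tn assms(9,10)]) (auto simp: \<sigma>_def)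
    then show ?thesis
    proof eventually_elim
      case (elim n)
      then have "?f \<eta> \<le> s H1 H2 (Tn n) k"
        using C by (simp add: pos_divide_le_eq mult.commute)
      then show ?case using \<eta>(1) by simp
    qed
  qed
  show ?thesis
    unfolding \<sigma>_def[symmetric]
  proof (rule order_tendstoI)
    fix c assume "\<sigma> < c"
    then show "\<forall>\<^sub>F n in sequentially. s H1 H2 (Tn n) k < c"
      using upper by (intro always_eventually allI) (rule le_less_trans)
  qed (rule lower)
qed

end
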